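(* Let $F$ be a field of characteristic $0$ and let $A_2 = M_2(F)\oplus F j_{11} \oplus F j_{12} \oplus F j_{22}$ (direct sum of ideals) where $j_{11}^2=j_{12}^2=j_{22}^2=0$. Let $T_2=\lbrace 0,v\rbrace$ be the semigroup with $v^2 =0^2= 0\cdot v=v\cdot 0=0$. Define a $T_2$-grading on $A_2$ by $A_2^{(0)}=(M_2(F),0)$, $A_2^{(v)}=\langle (e_{11}, j_{11}), (e_{12}, j_{12}), (e_{22}, j_{22})\rangle_F$, where $e_{ij}$ are the matrix units of $M_2(F)$. Then the limit $\lim_{n\to \infty} \sqrt[n]{c_n^{T_2\text{-}\mathrm{gr}}(A_2)}$ exists and equals $4+2\sqrt 2= 6.8284\ldots$
   Context: The pair $(a,b)$ denotes the element of $A_2$ with component $a\in M_2(F)$ and component $b\in Fj_{11}\oplus Fj_{12}\oplus Fj_{22}$. For a semigroup $T$, an algebra $A$ is $T$-graded if $A=\bigoplus_{t\in T}A^{(t)}$ (direct sum of subspaces) with $A^{(h)}A^{(t)}\subseteq A^{(ht)}$ for all $h,t\in T$. Graded codimensions: let $F\langle X^{T\text{-}\mathrm{gr}}\rangle$ be the free associative algebra (non-commutative polynomials) on the variables $x^{(t)}_i$, $t\in T$, $i\in\mathbb N$. A polynomial $f(x^{(t_1)}_{i_1},\dots,x^{(t_s)}_{i_s})$ is a graded polynomial identity of the $T$-graded algebra $A$ if it vanishes whenever each $x^{(t_j)}_{i_j}$ is replaced by an arbitrary element of $A^{(t_j)}$; the set of all of them is the ideal $\mathrm{Id}^{T\text{-}\mathrm{gr}}(A)$.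 Let $P^{T\text{-}\mathrm{gr}}_n$ be the $F$-linear span of all monomials $x^{(t_1)}_{\sigma(1)}x^{(t_2)}_{\sigma(2)}\cdots x^{(t_n)}_{\sigma(n)}$ with $t_i\in T$, $\sigma\in S_n$. The $n$th graded codimension is $c^{T\text{-}\mathrm{gr}}_n(A)=\dim_F\bigl(P^{T\text{-}\mathrm{gr}}_n/(P^{T\text{-}\mathrm{gr}}_n\cap \mathrm{Id}^{T\text{-}\mathrm{gr}}(A))\bigr)$. *)

theory Defs
  imports
    "HOL-Analysis.Analysis"
    "HOL-Library.Poly_Mapping"
    "HOL-Algebra.AbelCoset"
    "HOL-Combinatorics.Permutations"
    "Jordan_Normal_Form.Missing_VectorSpace"
begin

definition field_ring :: "'f::field ring" where
  "field_ring = \<lparr>carrier = UNIV, mult = (*), one = 1, zero = 0, add = (+)\<rparr>"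

text \<open>
  A subspace \<open>V\<close> of a type-based vector space as a module record, so that the dimension
  \<^const>\<open>vectorspace.dim\<close> for carrier-based vector spaces can be used.  The fields \<open>mult\<close> and
  \<open>one\<close>, inherited from the ring record, play no role for modules.
\<close>

definition subspace_module :: "('f \<Rightarrow> 'b \<Rightarrow> 'b) \<Rightarrow> 'b::ab_group_add set \<Rightarrow> ('f, 'b) module" where
  "subspace_module scl V =
     \<lparr>carrier = V, mult = undefined, one = undefined, zero = 0, add = (+), smult = scl\<rparr>"

definition quotient_module :: "('f, 'b) module \<Rightarrow> 'b set \<Rightarrow> ('f, 'b set) module" where
  "quotient_module M W =
     \<lparr>carrier = a_rcosets\<^bsub>M\<^esub> W, mult = undefined, one = undefined, zero = W, add = set_add M,
      smult = (\<lambda>c X. \<Union>x\<in>X. W +>\<^bsub>M\<^esub> (c \<odot>\<^bsub>M\<^esub> x))\<rparr>"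

lemma field_field_ring: "field (field_ring :: 'f::field ring)"
proof -
  have inv: "\<exists>y. x * y = 1" if "x \<noteq> 0" for x :: 'f
    using that by (intro exI[of _ "inverse x"]) auto
  have neg: "\<exists>y. x + y = 0" for x :: 'f
    by (intro exI[of _ "- x"]) auto
  show ?thesis
    by unfold_locales (auto simp: field_ring_def Units_def algebra_simps inv neg)
qed

lemma vectorspace_quotient_module:
  fixes scl :: "'f::field \<Rightarrow> 'b \<Rightarrow> 'b::ab_group_add"
  assumes vs: "vector_space scl"
    and V: "Modules.module.subspace scl V"
    and W: "Modules.module.subspace scl W" and WV: "W \<subseteq> V"
  shows "vectorspace field_ring (quotient_module (subspace_module scl V) W)"
proof -
  interpret vs: vector_space scl by (rule vs)
  let ?Q = "quotient_module (subspace_module scl V) W"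
  define q where "q x = {w + x | w. w \<in> W}" for x
  have carr: "carrier ?Q = q ` V"
    by (auto simp: quotient_module_def subspace_module_def A_RCOSETS_def' a_r_coset_def' q_def)
  have zero: "\<zero>\<^bsub>?Q\<^esub> = q 0"
    by (auto simp: quotient_module_def q_def)
  have q_iff: "z \<in> q x \<longleftrightarrow> z - x \<in> W" for z x
  proof
    assume "z - x \<in> W"
    then show "z \<in> q x"
      unfolding q_def by (intro CollectI exI[of _ "z - x"]) simp
  qed (auto simp: q_def)
  have add: "q x \<oplus>\<^bsub>?Q\<^esub> q y = q (x + y)" for x y
  proof -
    have "q x \<oplus>\<^bsub>?Q\<^esub> q y = {z1 + z2 | z1 z2. z1 \<in> q x \<and> z2 \<in> q y}"
      by (auto simp: quotient_module_def subspace_module_def set_add_def')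
    also have "\<dots> = q (x + y)"
    proof (intro equalityI subsetI)
      fix z assume "z \<in> {z1 + z2 | z1 z2. z1 \<in> q x \<and> z2 \<in> q y}"
      then obtain z1 z2 where z: "z = z1 + z2" "z1 - x \<in> W" "z2 - y \<in> W"
        unfolding q_iff by blast
      have "z - (x + y) = (z1 - x) + (z2 - y)"
        by (simp add: z(1))
      then show "z \<in> q (x + y)"
        unfolding q_iff using vs.subspace_add[OF W z(2,3)] by metis
    next
      fix z assume "z \<in> q (x + y)"
      then have "z - y \<in> q x" "y \<in> q y" "z = (z - y) + y"
        using vs.subspace_0[OF W] unfolding q_iff by (simp_all add: algebra_simps)
      then show "z \<in> {z1 + z2 | z1 z2. z1 \<in> q x \<and> z2 \<in> q y}"
        by blast
    qed
    finally show ?thesis .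
  qed
  have smult: "c \<odot>\<^bsub>?Q\<^esub> q x = q (scl c x)" for c x
  proof -
    have "c \<odot>\<^bsub>?Q\<^esub> q x = (\<Union>z\<in>q x. q (scl c z))"
      by (simp add: quotient_module_def subspace_module_def a_r_coset_def' q_def Setcompr_eq_image UNION_singleton_eq_range)
    also have "\<dots> = (\<Union>z\<in>q x. q (scl c x))"
    proof (rule SUP_cong[OF refl])
      fix z assume "z \<in> q x"
      then have zx: "scl c z - scl c x \<in> W"
        unfolding q_iff using vs.subspace_scale[OF W, of "z - x" c]
        by (simp add: vs.scale_right_diff_distrib)
      show "q (scl c z) = q (scl c x)"
      proof (rule Set.set_eqI)
        fix u
        have "u - scl c x = (u - scl c z) + (scl c z - scl c x)"
          "u - scl c z = (u - scl c x) - (scl c z - scl c x)"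
          by simp_all
        then show "u \<in> q (scl c z) \<longleftrightarrow> u \<in> q (scl c x)"
          unfolding q_iff using vs.subspace_add[OF W _ zx] vs.subspace_diff[OF W _ zx] by metis
      qed
    qed
    also have "\<dots> = q (scl c x)"
    proof -
      have "x \<in> q x"
        using vs.subspace_0[OF W] by (simp add: q_iff)
      then show ?thesis
        by blast
    qed
    finally show ?thesis .
  qed
  have neg: "\<exists>y\<in>V. q (y + x) = q 0" if "x \<in> V" for x
    using vs.subspace_neg[OF V that] by (intro bexI[of _ "- x"]) auto
  note closed = vs.subspace_0[OF V] vs.subspace_add[OF V] vs.subspace_scale[OF V]
  have ab: "abelian_group ?Q"
  proof (rule abelian_groupI)
    fix X assume "X \<in> carrier ?Q"
    then obtain x where "x \<in> V" "X = q x"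
      unfolding carr by blast
    then show "\<exists>Y\<in>carrier ?Q. Y \<oplus>\<^bsub>?Q\<^esub> X = \<zero>\<^bsub>?Q\<^esub>"
      unfolding carr zero using neg[of x] add by auto
  qed (auto simp: carr zero add closed ac_simps)
  interpret F: field "field_ring :: 'f ring" by (rule field_field_ring)
  have "Module.module field_ring ?Q"
  proof (rule moduleI[OF F.is_cring ab])
    show "c \<odot>\<^bsub>?Q\<^esub> X \<in> carrier ?Q" if "X \<in> carrier ?Q" for c X
      using that unfolding carr by (auto simp: smult closed)
  qed (unfold carr, auto simp: field_ring_def smult add vs.scale_left_distrib vs.scale_right_distrib)
  then show ?thesis
    by (intro vectorspace.intro field_field_ring)
qed

text \<open>
  Words under concatenation form the free monoid, written additively because
  \<^type>\<open>poly_mapping\<close> builds its convolution product from an additive monoid.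
  Hence \<open>'x fword \<Rightarrow>\<^sub>0 'f\<close>, with its ring structure from the library, is the free associative
  unital algebra over \<open>'f\<close> on the variables \<open>'x\<close>.
\<close>

datatype 'x fword = FWord (letters: "'x list")

instantiation fword :: (type) monoid_add
begin

definition zero_fword :: "'a fword" where
  "zero_fword = FWord []"

definition plus_fword :: "'a fword \<Rightarrow> 'a fword \<Rightarrow> 'a fword" where
  "plus_fword u v = FWord (letters u @ letters v)"

instance
  by standard (simp_all add: zero_fword_def plus_fword_def)

end

definition poly_scale :: "'f::mult_zero \<Rightarrow> ('w \<Rightarrow>\<^sub>0 'f) \<Rightarrow> ('w \<Rightarrow>\<^sub>0 'f)" where
  "poly_scale c f = Poly_Mapping.map ((*) c) f"

lemma lookup_poly_scale: "Poly_Mapping.lookup (poly_scale c f) w = c * Poly_Mapping.lookup f w"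
  by (simp add: poly_scale_def Poly_Mapping.map.rep_eq when_def)

lemma vector_space_poly_scale: "vector_space (poly_scale :: 'f::field \<Rightarrow> ('w \<Rightarrow>\<^sub>0 'f) \<Rightarrow> _)"
  by standard (auto intro!: poly_mapping_eqI simp: lookup_poly_scale lookup_add algebra_simps)

text \<open>The variable \<open>(t, i)\<close> stands for \<open>x\<^sub>i\<close> with superscript \<open>(t)\<close>.\<close>

type_synonym ('t, 'f) gr_poly = "('t \<times> nat) fword \<Rightarrow>\<^sub>0 'f"

definition gr_var :: "'t \<Rightarrow> nat \<Rightarrow> ('t, 'f::zero_neq_one) gr_poly" where
  "gr_var t i = Poly_Mapping.single (FWord [(t, i)]) 1"

locale graded_algebra = vector_space scl
  for scl :: "'f::field \<Rightarrow> 'a::ring \<Rightarrow> 'a" +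
  fixes gr :: "'t::semigroup_mult \<Rightarrow> 'a set"
  assumes scale_mult_left: "scl c x * y = scl c (x * y)"
    and scale_mult_right: "x * scl c y = scl c (x * y)"
    and subspace_gr: "subspace (gr t)"
    and direct_sum: "\<exists>!p. finite {t. p t \<noteq> 0} \<and> (\<forall>t. p t \<in> gr t) \<and> x = (\<Sum>t | p t \<noteq> 0. p t)"
    and gr_mult: "x \<in> gr s \<Longrightarrow> y \<in> gr t \<Longrightarrow> x * y \<in> gr (s * t)"

text \<open>Algebras need not have a unit, so the empty product has no value.\<close>

fun nonempty_prod :: "'a::times list \<Rightarrow> 'a" where
  "nonempty_prod [x] = x"
| "nonempty_prod (x # y # zs) = x * nonempty_prod (y # zs)"

definition substitute ::
    "('f::zero \<Rightarrow> 'a \<Rightarrow> 'a) \<Rightarrow> ('x \<Rightarrow> 'a::ring) \<Rightarrow> ('x fword \<Rightarrow>\<^sub>0 'f) \<Rightarrow> 'a" where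
  "substitute scl \<phi> f =
     (\<Sum>w\<in>Poly_Mapping.keys f. scl (Poly_Mapping.lookup f w) (nonempty_prod (map \<phi> (letters w))))"

text \<open>
  Identities of possibly non-unital algebras are polynomials without constant term, i.e. elements
  of the free non-unital algebra.
\<close>

definition graded_identities ::
    "('f::zero \<Rightarrow> 'a \<Rightarrow> 'a) \<Rightarrow> ('t \<Rightarrow> 'a::ring set) \<Rightarrow> ('t, 'f) gr_poly set" where
  "graded_identities scl gr =
     {f. Poly_Mapping.lookup f 0 = 0 \<and>
         (\<forall>\<phi>. (\<forall>t i. \<phi> (t, i) \<in> gr t) \<longrightarrow> substitute scl \<phi> f = 0)}"

lemma (in graded_algebra) subspace_graded_identities:
  "Modules.module.subspace poly_scale (graded_identities scl gr)"
proof -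
  interpret P: vector_space "poly_scale :: 'f \<Rightarrow> ('t, 'f) gr_poly \<Rightarrow> _"
    by (rule vector_space_poly_scale)
  have ext: "substitute scl \<phi> f =
      (\<Sum>w\<in>K. scl (Poly_Mapping.lookup f w) (nonempty_prod (map \<phi> (letters w))))"
    if "finite K" "Poly_Mapping.keys f \<subseteq> K" for K \<phi> and f :: "('t, 'f) gr_poly"
    unfolding substitute_def using that
    by (intro sum.mono_neutral_left) (auto simp: in_keys_iff)
  have zero: "substitute scl \<phi> (0 :: ('t, 'f) gr_poly) = 0" for \<phi>
    by (simp add: substitute_def)
  have add: "substitute scl \<phi> (f + g) = substitute scl \<phi> f + substitute scl \<phi> g"
    for \<phi> and f g :: "('t, 'f) gr_poly"
    using Poly_Mapping.keys_add[of f g]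
    by (simp add: ext[of "Poly_Mapping.keys f \<union> Poly_Mapping.keys g"] lookup_add
        scale_left_distrib sum.distrib)
  have "Poly_Mapping.keys (poly_scale c f) \<subseteq> Poly_Mapping.keys f"
    for c and f :: "('t, 'f) gr_poly"
    by (auto simp: in_keys_iff lookup_poly_scale)
  then have scale: "substitute scl \<phi> (poly_scale c f) = scl c (substitute scl \<phi> f)"
    for \<phi> c and f :: "('t, 'f) gr_poly"
    by (simp add: ext[of "Poly_Mapping.keys f"] lookup_poly_scale scale_sum_right)
  show ?thesis
    by (auto simp: P.subspace_def graded_identities_def zero add scale lookup_add lookup_poly_scale)
qed

definition multilinear_polys :: "nat \<Rightarrow> ('t, 'f::field) gr_poly set" where
  "multilinear_polys n =
     Modules.module.span poly_scale
       {prod_list (map (\<lambda>k. gr_var (t k) (\<sigma> k)) [1..<Suc n]) | t \<sigma>. \<sigma> permutes {1..n}}"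

text \<open>
  For finite \<open>'t\<close> the quotient is finite-dimensional, being spanned by finitely many monomials;
  \<^const>\<open>vectorspace.dim\<close> has no meaningful value on infinite-dimensional spaces.
\<close>

definition graded_codim ::
    "('f::field \<Rightarrow> 'a \<Rightarrow> 'a) \<Rightarrow> ('t \<Rightarrow> 'a::ring set) \<Rightarrow> nat \<Rightarrow> nat" where
  "graded_codim scl gr n =
     vectorspace.dim field_ring
       (quotient_module (subspace_module poly_scale (multilinear_polys n))
          (multilinear_polys n \<inter> graded_identities scl gr))"

lemma (in graded_algebra) vectorspace_graded_codim:
  "vectorspace field_ring
     (quotient_module (subspace_module poly_scale (multilinear_polys n))
        (multilinear_polys n \<inter> graded_identities scl gr))"
proof -
  interpret P: vector_space "poly_scale :: 'f \<Rightarrow> ('t, 'f) gr_poly \<Rightarrow> _"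
    by (rule vector_space_poly_scale)
  have "P.subspace (multilinear_polys n)"
    by (simp add: multilinear_polys_def)
  then show ?thesis
    by (intro vectorspace_quotient_module vector_space_poly_scale P.subspace_inter
        subspace_graded_identities) auto
qed

datatype T2 = T2_zero | T2_v

instantiation T2 :: semigroup_mult
begin

definition times_T2 :: "T2 \<Rightarrow> T2 \<Rightarrow> T2" where
  "times_T2 s t = T2_zero"

instance
  by standard (simp add: times_T2_def)

end

text \<open>
  \<open>A2 a (b\<^sub>1, b\<^sub>2, b\<^sub>3)\<close> is the pair with components \<open>a\<close> and
  \<open>b\<^sub>1 j\<^sub>1\<^sub>1 + b\<^sub>2 j\<^sub>1\<^sub>2 + b\<^sub>3 j\<^sub>2\<^sub>2\<close>.  Distinct ideals of the direct sum annihilate each other and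
  each \<open>j\<close> squares to zero, so the second components multiply trivially.  A separate type is
  needed since the library's product on \<open>'f^2^2\<close> is entrywise.
\<close>

datatype 'f A2 = A2 (mat_part: "'f^2^2") (nil_part: "'f \<times> 'f \<times> 'f")

instantiation A2 :: (field) ring
begin

definition zero_A2 :: "'a A2" where
  "0 = A2 0 0"

definition plus_A2 :: "'a A2 \<Rightarrow> 'a A2 \<Rightarrow> 'a A2" where
  "x + y = A2 (mat_part x + mat_part y) (nil_part x + nil_part y)"

definition minus_A2 :: "'a A2 \<Rightarrow> 'a A2 \<Rightarrow> 'a A2" where
  "x - y = A2 (mat_part x - mat_part y) (nil_part x - nil_part y)"

definition uminus_A2 :: "'a A2 \<Rightarrow> 'a A2" where
  "- x = A2 (- mat_part x) (- nil_part x)"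

definition times_A2 :: "'a A2 \<Rightarrow> 'a A2 \<Rightarrow> 'a A2" where
  "x * y = A2 (mat_part x ** mat_part y) 0"

instance
proof -
  have "(a + b) ** c = a ** c + b ** c" for a b c :: "'a^2^2"
    by (simp add: matrix_matrix_mult_def vec_eq_iff sum.distrib algebra_simps)
  then show "OFCLASS('a A2, ring_class)"
    by intro_classes
      (simp_all add: zero_A2_def plus_A2_def minus_A2_def uminus_A2_def times_A2_def A2.expand
        algebra_simps matrix_mul_assoc matrix_add_ldistrib)
qed

end

definition A2_scale :: "'f::field \<Rightarrow> 'f A2 \<Rightarrow> 'f A2" where
  "A2_scale c x =
     A2 (\<chi> i j. c * mat_part x $ i $ j) (case nil_part x of (b1, b2, b3) \<Rightarrow> (c * b1, c * b2, c * b3))"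

definition mat_unit :: "2 \<Rightarrow> 2 \<Rightarrow> 'f::zero_neq_one^2^2" where
  "mat_unit i j = (\<chi> k l. if k = i \<and> l = j then 1 else 0)"

fun A2_grading :: "T2 \<Rightarrow> 'f::field A2 set" where
  "A2_grading T2_zero = range (\<lambda>a. A2 a 0)"
| "A2_grading T2_v =
     Modules.module.span A2_scale
       {A2 (mat_unit 1 1) (1, 0, 0), A2 (mat_unit 1 2) (0, 1, 0), A2 (mat_unit 2 2) (0, 0, 1)}"

lemma graded_algebra_A2: "graded_algebra (A2_scale :: 'f::field \<Rightarrow> 'f A2 \<Rightarrow> 'f A2) A2_grading"
proof -
  note A2_defs = zero_A2_def plus_A2_def minus_A2_def times_A2_def A2_scale_def zero_prod_def
  interpret vector_space "A2_scale :: 'f \<Rightarrow> 'f A2 \<Rightarrow> 'f A2"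
    by standard
      (auto simp: A2_defs vec_eq_iff algebra_simps split: prod.splits intro!: A2.expand)
  define v :: "'f \<Rightarrow> 'f \<Rightarrow> 'f \<Rightarrow> 'f A2" where
    "v = (\<lambda>a b c. A2 (\<chi> i j. if i = 1 then if j = 1 then a else b else if j = 1 then 0 else c) (a, b, c))"
  have "x \<in> A2_grading T2_v \<longleftrightarrow> (\<exists>a b c. x = v a b c)" for x
    by (cases x) (auto simp: span_breakdown_eq v_def A2_defs mat_unit_def vec_eq_iff forall_2)
  then have v_iff: "A2_grading T2_v = {v a b c | a b c. True}"
    by auto
  have zero_iff: "A2_grading T2_zero = {x :: 'f A2. nil_part x = 0}"
    by (auto simp: image_iff) (metis A2.collapse)
  have T2_split: "(\<forall>t. P t) \<longleftrightarrow> P T2_zero \<and> P T2_v" for P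
    by (metis T2.exhaust)
  have T2_UNIV: "UNIV = {T2_zero, T2_v}"
    by (auto intro: T2.exhaust)
  have fin: "finite (A :: T2 set)" for A
    by (rule finite_subset[OF subset_UNIV]) (simp add: T2_UNIV)
  have sum_T2: "(\<Sum>t | p t \<noteq> 0. p t) = p T2_zero + p T2_v" for p :: "T2 \<Rightarrow> 'f A2"
  proof -
    have "(\<Sum>t | p t \<noteq> 0. p t) = (\<Sum>t\<in>UNIV. p t)"
      by (rule sum.mono_neutral_left) (auto simp: fin)
    then show ?thesis
      by (simp add: T2_UNIV)
  qed
  show ?thesis
  proof
    fix t
    show "subspace (A2_grading t :: 'f A2 set)"
    proof (cases t)
      case T2_zero
      then show ?thesis
        by (auto simp: subspace_def zero_iff A2_defs simp del: A2_grading.simps)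
    next
      case T2_v
      then show ?thesis
        by simp
    qed
  next
    fix x :: "'f A2"
    obtain m a b c where x: "x = A2 m (a, b, c)"
      by (metis A2.exhaust prod_cases3)
    define p where "p t = (case t of T2_zero \<Rightarrow> x - v a b c | T2_v \<Rightarrow> v a b c)" for t
    have p: "p T2_zero \<in> A2_grading T2_zero" "p T2_v \<in> A2_grading T2_v" "x = p T2_zero + p T2_v"
      unfolding zero_iff v_iff by (auto simp: p_def x v_def A2_defs)
    have uniq: "q = p" if q: "q T2_zero \<in> A2_grading T2_zero" "q T2_v \<in> A2_grading T2_v" "x = q T2_zero + q T2_v" for q
    proof -
      have "q T2_v = v a b c"
        using q unfolding zero_iff v_iff by (auto simp: x A2_defs) (auto simp: v_def)
      moreover from this have "q T2_zero = x - v a b c"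
        using q(3) by simp
      ultimately show ?thesis
        unfolding fun_eq_iff T2_split by (simp add: p_def)
    qed
    show "\<exists>!p. finite {t. p t \<noteq> 0} \<and> (\<forall>t. p t \<in> A2_grading t) \<and> x = (\<Sum>t | p t \<noteq> 0. p t)"
      unfolding sum_T2 T2_split using fin p uniq by blast
  next
    fix x y :: "'f A2" and s t
    show "x * y \<in> A2_grading (s * t)"
      by (auto simp: times_T2_def times_A2_def)
  qed (auto simp: A2_defs vec_eq_iff matrix_matrix_mult_def sum_distrib_left algebra_simps split: prod.splits)
qed

end

theory Submission
  imports Defs "HOL-Library.Function_Algebras"
begin

text \<open>
  For \<open>n \<ge> 2\<close> only the matrix components matter: a variable of degree \<open>0\<close> runs over all four matrix
  units and one of degree \<open>v\<close> over \<open>e\<^sub>1\<^sub>1, e\<^sub>1\<^sub>2, e\<^sub>2\<^sub>2\<close>.  Give \<open>e\<^sub>1\<^sub>2\<close> weight \<open>1\<close>, \<open>e\<^sub>2\<^sub>1\<close> weight \<open>-1\<close> and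
  the diagonal units weight \<open>0\<close>, so that the seven letters have generating function
  \<open>4 + 2 z + 1 / z\<close>, whose minimum over \<open>z > 0\<close> is \<open>4 + 2 sqrt 2\<close>, attained at \<open>z = 1 / sqrt 2\<close>.

  Upper bound: by multilinearity a polynomial is an identity as soon as it vanishes on all words in
  these letters, and a product of matrix units can only be nonzero if its total weight is at most
  \<open>1\<close> in absolute value.

  Lower bound: a word of total weight \<open>0\<close> with nonnegative partial weights, in which \<open>e\<^sub>2\<^sub>2\<close> only
  occurs where the partial weight is positive, is cut into
  noncrossing blocks, each beginning with \<open>e\<^sub>1\<^sub>2\<close> and ending with \<open>e\<^sub>2\<^sub>1\<close> (or consisting of a single
  \<open>e\<^sub>1\<^sub>1\<close>).  The products of the traces of the blocks, evaluated at the words, form a matrix that is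
  unitriangular for the lexicographic order.  At the cost of three additional variables these
  products of traces are entries of polynomials without traces.  The number of such words grows like
  the largest eigenvalues \<open>4 + 2 sqrt 2 cos (\<pi> / (L + 1))\<close> of the walks confined to a strip of
  height \<open>L\<close>, which tend to \<open>4 + 2 sqrt 2\<close>.
\<close>

section \<open>Dimensions of quotient spaces\<close>

text \<open>The coset of \<open>x\<close> modulo \<open>W\<close>, in the form to which the elements
  of the carrier of the quotient module unfold.\<close>

definition translate :: "'b::plus set \<Rightarrow> 'b \<Rightarrow> 'b set" where
  "translate W x = {w + x | w. w \<in> W}"

text \<open>Moves linear combinations of cosets to representatives. \<open>lincomb\<close> is
  indexed by the set of cosets, so distinct representatives must have distinct cosets.\<close>

lemma lincomb_quotient:
  fixes scl :: "'f::field \<Rightarrow> 'b \<Rightarrow> 'b::ab_group_add"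
  assumes vs: "vector_space scl" and V: "Modules.module.subspace scl V"
    and W: "Modules.module.subspace scl W" and WV: "W \<subseteq> V"
    and C: "finite C" "C \<subseteq> V"
  defines "Q \<equiv> quotient_module (subspace_module scl V) W"
    and "q \<equiv> translate W"
  assumes inj: "inj_on q C"
  shows "carrier Q = q ` V" "\<zero>\<^bsub>Q\<^esub> = q 0"
    and "module.lincomb Q a (q ` C) = q (\<Sum>c\<in>C. scl (a (q c)) c)"
proof -
  interpret vs: vector_space scl by (rule vs)
  interpret Q: vectorspace field_ring Q
    unfolding Q_def by (rule vectorspace_quotient_module[OF vs V W WV])
  show carr: "carrier Q = q ` V"
    by (auto simp: Q_def quotient_module_def subspace_module_def A_RCOSETS_def' a_r_coset_def' q_def translate_def)
  show zero: "\<zero>\<^bsub>Q\<^esub> = q 0"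
    by (auto simp: Q_def quotient_module_def q_def translate_def)
  have q_iff: "z \<in> q x \<longleftrightarrow> z - x \<in> W" for z x
  proof
    assume "z - x \<in> W"
    then show "z \<in> q x"
      unfolding q_def translate_def by (intro CollectI exI[of _ "z - x"]) simp
  qed (auto simp: q_def translate_def)
  have q_eq: "q x = q y" if "x - y \<in> W" for x y
  proof (rule Set.set_eqI)
    fix u
    have "u - y = (u - x) + (x - y)" "u - x = (u - y) - (x - y)"
      by simp_all
    then show "u \<in> q x \<longleftrightarrow> u \<in> q y"
      unfolding q_iff using vs.subspace_add[OF W _ that] vs.subspace_diff[OF W _ that] by metis
  qed
  have add: "q x \<oplus>\<^bsub>Q\<^esub> q y = q (x + y)" for x y
  proof -
    have "q x \<oplus>\<^bsub>Q\<^esub> q y = {z1 + z2 | z1 z2. z1 \<in> q x \<and> z2 \<in> q y}"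
      by (auto simp: Q_def quotient_module_def subspace_module_def set_add_def')
    also have "\<dots> = q (x + y)"
    proof (intro equalityI subsetI)
      fix z assume "z \<in> {z1 + z2 | z1 z2. z1 \<in> q x \<and> z2 \<in> q y}"
      then obtain z1 z2 where z: "z = z1 + z2" "z1 - x \<in> W" "z2 - y \<in> W"
        unfolding q_iff by blast
      then show "z \<in> q (x + y)"
        unfolding q_iff using vs.subspace_add[OF W z(2,3)] by (simp add: algebra_simps)
    next
      fix z assume "z \<in> q (x + y)"
      then have "z - y \<in> q x" "y \<in> q y" "z = (z - y) + y"
        using vs.subspace_0[OF W] unfolding q_iff by (simp_all add: algebra_simps)
      then show "z \<in> {z1 + z2 | z1 z2. z1 \<in> q x \<and> z2 \<in> q y}"
        by blast
    qed
    finally show ?thesis .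
  qed
  have smult: "c \<odot>\<^bsub>Q\<^esub> q x = q (scl c x)" for c x
  proof -
    have "c \<odot>\<^bsub>Q\<^esub> q x = (\<Union>z\<in>q x. q (scl c z))"
      by (simp add: Q_def quotient_module_def subspace_module_def a_r_coset_def' q_def translate_def
          Setcompr_eq_image UNION_singleton_eq_range)
    also have "\<dots> = (\<Union>z\<in>q x. q (scl c x))"
      using vs.subspace_scale[OF W, of _ c]
      by (intro SUP_cong[OF refl] q_eq) (simp add: q_iff flip: vs.scale_right_diff_distrib)
    also have "\<dots> = q (scl c x)"
      using vs.subspace_0[OF W] q_iff[of x x] by auto
    finally show ?thesis .
  qed
  have in_V: "\<And>c x. x \<in> V \<Longrightarrow> scl c x \<in> V" "0 \<in> V"
    using vs.subspace_scale[OF V] vs.subspace_0[OF V] by blast+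
  have "finsum Q (\<lambda>v. a v \<odot>\<^bsub>Q\<^esub> v) (q ` C) = q (\<Sum>c\<in>C. scl (a (q c)) c)"
    using C inj
  proof (induction C rule: finite_induct)
    case (insert x C)
    have "(\<lambda>v. a v \<odot>\<^bsub>Q\<^esub> v) \<in> q ` C \<rightarrow> carrier Q" "a (q x) \<odot>\<^bsub>Q\<^esub> q x \<in> carrier Q"
      using insert.prems in_V by (auto simp: carr smult)
    moreover have "q x \<notin> q ` C"
      using insert.hyps insert.prems(2) by (auto simp: inj_on_def)
    ultimately show ?case
      using insert by (simp add: smult add)
  qed (simp add: zero)
  then show "module.lincomb Q a (q ` C) = q (\<Sum>c\<in>C. scl (a (q c)) c)"
    by (simp add: Q.lincomb_def)
qed

text \<open>The projection is injective on the span of \<open>C\<close>, which meets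
  \<open>W\<close> only in 0, and by \<open>cover\<close> it maps this span onto the quotient; hence
  it carries the independent set \<open>C\<close> to a basis.\<close>

lemma dim_quotient_complement:
  fixes scl :: "'f::field \<Rightarrow> 'b \<Rightarrow> 'b::ab_group_add"
  assumes vs: "vector_space scl" and V: "Modules.module.subspace scl V"
    and W: "Modules.module.subspace scl W" and WV: "W \<subseteq> V"
    and C: "finite C" "C \<subseteq> V"
    and indep: "\<not> Modules.module.dependent scl C"
    and disj: "Modules.module.span scl C \<inter> W = {0}"
    and cover: "\<And>x. x \<in> V \<Longrightarrow> \<exists>y\<in>Modules.module.span scl C. x - y \<in> W"
  shows "vectorspace.dim field_ring (quotient_module (subspace_module scl V) W) = card C"
proof -
  define Q where "Q = quotient_module (subspace_module scl V) W"
  define q where "q = translate W"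
  interpret vs: vector_space scl by (rule vs)
  interpret Q: vectorspace field_ring Q
    unfolding Q_def by (rule vectorspace_quotient_module[OF vs V W WV])
  have q_eqD: "x - y \<in> W" if "q x = q y" for x y
  proof -
    have "x \<in> q x" using vs.subspace_0[OF W] by (force simp: q_def translate_def)
    then have "x \<in> q y" using that by simp
    then show ?thesis by (auto simp: q_def translate_def)
  qed
  have q_eqI: "q x = q y" if "x - y \<in> W" for x y
  proof -
    have "w + x = (w + (x - y)) + y" "w + y = (w - (x - y)) + x" for w
      by simp_all
    then show ?thesis
      unfolding q_def translate_def using vs.subspace_add[OF W _ that] vs.subspace_diff[OF W _ that] by blast
  qed
  have inj: "inj_on q C"
  proof (rule inj_onI)
    fix x y assume "x \<in> C" "y \<in> C" "q x = q y"
    then have "x - y \<in> vs.span C \<inter> W"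
      using q_eqD by (auto intro: vs.span_diff vs.span_base)
    then show "x = y" using disj by auto
  qed
  note lc = lincomb_quotient[OF vs V W WV C, folded Q_def q_def, OF inj]
  have sub: "q ` C \<subseteq> carrier Q"
    using C by (auto simp: lc(1))
  have carr_F: "carrier field_ring = (UNIV :: 'f set)" and zero_F: "\<zero>\<^bsub>field_ring\<^esub> = (0 :: 'f)"
    by (simp_all add: field_ring_def)
  have "Q.lin_indpt (q ` C)"
  proof (rule Q.finite_lin_indpt2)
    fix a :: "'b set \<Rightarrow> 'f" assume "Q.lincomb a (q ` C) = \<zero>\<^bsub>Q\<^esub>"
    then have "(\<Sum>c\<in>C. scl (a (q c)) c) \<in> W"
      using q_eqD[of _ 0] by (simp add: lc)
    moreover have "(\<Sum>c\<in>C. scl (a (q c)) c) \<in> vs.span C"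
      by (intro vs.span_sum vs.span_scale vs.span_base)
    ultimately have "(\<Sum>c\<in>C. scl (a (q c)) c) = 0"
      using disj by blast
    then show "\<forall>v\<in>q ` C. a v = \<zero>\<^bsub>field_ring\<^esub>"
      using indep C(1) vs.dependent_finite[OF C(1)] by (auto simp: zero_F)
  qed (use C sub in auto)
  moreover have "Q.gen_set (q ` C)"
  proof
    show "Q.span (q ` C) \<subseteq> carrier Q"
      using C sub by (intro Q.span_is_subset2) auto
    show "carrier Q \<subseteq> Q.span (q ` C)"
    proof
      fix X assume "X \<in> carrier Q"
      then obtain x where x: "x \<in> V" "X = q x" by (auto simp: lc(1))
      then obtain y where y: "y \<in> vs.span C" "x - y \<in> W" using cover by blast
      then obtain u where u: "y = (\<Sum>c\<in>C. scl (u c) c)"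
        using vs.span_finite[OF C(1)] by auto
      \<comment> \<open>\<open>inv_into C q\<close> turns coefficients indexed by representatives
        into coefficients indexed by cosets.\<close>
      have "X = q (\<Sum>c\<in>C. scl ((u \<circ> inv_into C q) (q c)) c)"
        using q_eqI[OF y(2)] x(2) u inv_into_f_f[OF inj] by simp
      also have "\<dots> = Q.lincomb (u \<circ> inv_into C q) (q ` C)"
        by (simp add: lc(3))
      finally show "X \<in> Q.span (q ` C)"
        using C by (auto simp: Q.finite_span[OF _ sub] carr_F)
    qed
  qed
  ultimately have "Q.basis (q ` C)"
    using sub by (simp add: Q.basis_def)
  then have "Q.dim = card (q ` C)"
    using C(1) by (intro Q.dim_basis) auto
  then show ?thesis
    using inj by (simp add: Q_def card_image)
qed

text \<open>A basis \<open>D\<close> of \<open>W\<close> is extended to a basis \<open>E\<close> of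
  \<open>V\<close>; then \<open>E - D\<close> spans a complement.\<close>

lemma quotient_complement_exists:
  fixes scl :: "'f::field \<Rightarrow> 'b \<Rightarrow> 'b::ab_group_add"
  assumes vs: "vector_space scl" and W: "Modules.module.subspace scl W" "W \<subseteq> V"
    and V: "V = Modules.module.span scl B" "finite B"
  obtains C where "finite C" "C \<subseteq> V" "\<not> Modules.module.dependent scl C"
    "Modules.module.span scl C \<inter> W = {0}"
    "\<And>x. x \<in> V \<Longrightarrow> \<exists>y\<in>Modules.module.span scl C. x - y \<in> W"
    "vectorspace.dim field_ring (quotient_module (subspace_module scl V) W) = card C"
proof -
  interpret vs: vector_space scl by (rule vs)
  obtain D where D: "D \<subseteq> W" "vs.independent D" "W \<subseteq> vs.span D"
    using vs.maximal_independent_subset by blast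
  have DV: "D \<subseteq> V" using D W by auto
  obtain E where E: "D \<subseteq> E" "E \<subseteq> V" "vs.independent E" "V \<subseteq> vs.span E"
    using vs.maximal_independent_subset_extend[OF DV D(2)] by blast
  have finE: "finite E"
    using vs.independent_span_bound[OF V(2) E(3)] E(2) V(1) by blast
  define C where "C = E - D"
  have spanD: "vs.span D = W"
    using D W(1) by (metis subset_antisym vs.span_minimal)
  have disj: "vs.span C \<inter> W = {0}"
  proof (intro equalityI subsetI)
    fix x assume x: "x \<in> vs.span C \<inter> W"
    have "finite C" "finite D"
      using finE E(1) by (auto simp: C_def intro: finite_subset)
    then have "x \<in> range (\<lambda>u. \<Sum>c\<in>C. scl (u c) c)" "x \<in> range (\<lambda>v. \<Sum>d\<in>D. scl (v d) d)"
      using x unfolding spanD[symmetric] by (simp_all add: vs.span_finite)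
    then obtain u v where u: "x = (\<Sum>c\<in>C. scl (u c) c)" and v: "x = (\<Sum>d\<in>D. scl (v d) d)"
      by (elim rangeE)
    \<comment> \<open>The difference of the two expansions of \<open>x\<close>, a linear relation on
      the basis \<open>E\<close>.\<close>
    let ?r = "\<lambda>e. if e \<in> C then u e else - v e"
    have "(\<Sum>e\<in>E. scl (?r e) e) = (\<Sum>c\<in>C. scl (?r c) c) + (\<Sum>d\<in>D. scl (?r d) d)"
      using finE E(1) unfolding C_def by (subst sum.subset_diff[of D E]) (auto intro: finite_subset)
    also have "(\<Sum>d\<in>D. scl (?r d) d) = (\<Sum>d\<in>D. - scl (v d) d)"
      by (intro sum.cong) (auto simp: C_def)
    also have "(\<Sum>c\<in>C. scl (?r c) c) = (\<Sum>c\<in>C. scl (u c) c)"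
      by (intro sum.cong) auto
    finally have "(\<Sum>e\<in>E. scl (?r e) e) = 0"
      using u v by (simp add: sum_negf)
    then have "vs.dependent E" if "\<not> (\<forall>e\<in>E. ?r e = 0)"
      unfolding vs.dependent_finite[OF finE] using that by (intro exI[of _ ?r]) simp
    then have "\<forall>e\<in>E. ?r e = 0"
      using E(3) by blast
    then have "\<forall>c\<in>C. u c = 0"
      by (metis C_def DiffD1)
    then show "x \<in> {0}" using u by simp
  qed (use vs.span_zero vs.subspace_0[OF W(1)] in auto)
  have cover: "\<exists>y\<in>vs.span C. x - y \<in> W" if "x \<in> V" for x
  proof -
    have "x \<in> vs.span (C \<union> D)"
      using that E(1,4) by (auto simp: C_def Un_absorb2)
    then obtain y z where "y \<in> vs.span C" "z \<in> W" "x = y + z"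
      unfolding vs.span_Un spanD by blast
    then show ?thesis by (intro bexI[of _ y]) auto
  qed
  have C: "finite C" "C \<subseteq> V" "vs.independent C"
    using finE E vs.independent_mono[OF E(3)] by (auto simp: C_def)
  have "vs.subspace V" by (simp add: V(1))
  then show ?thesis
    using that[OF C disj cover] dim_quotient_complement[OF vs _ W C(1,2,3) disj cover] by blast
qed

text \<open>Together the functionals embed a complement of \<open>W\<close> into the functions on
  \<open>J\<close>, since an element of \<open>V\<close> killed by all of them lies in
  \<open>W\<close>.\<close>

lemma dim_quotient_le:
  fixes scl :: "'f::field \<Rightarrow> 'b \<Rightarrow> 'b::ab_group_add" and l :: "'j \<Rightarrow> 'b \<Rightarrow> 'f"
  assumes vs: "vector_space scl" and W: "Modules.module.subspace scl W" "W \<subseteq> V"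
    and V: "V = Modules.module.span scl B" "finite B"
    and J: "finite J" and lin: "\<And>j. j \<in> J \<Longrightarrow> Vector_Spaces.linear scl (*) (l j)"
    and ker: "\<And>x. x \<in> V \<Longrightarrow> (\<And>j. j \<in> J \<Longrightarrow> l j x = 0) \<Longrightarrow> x \<in> W"
  shows "vectorspace.dim field_ring (quotient_module (subspace_module scl V) W) \<le> card J"
proof -
  interpret vs: vector_space scl by (rule vs)
  obtain C where C: "finite C" "C \<subseteq> V" "vs.independent C" "vs.span C \<inter> W = {0}"
    and dim: "vectorspace.dim field_ring (quotient_module (subspace_module scl V) W) = card C"
    using quotient_complement_exists[OF vs W V] by metis
  interpret fn: vector_space "\<lambda>(c::'f) (f::'j \<Rightarrow> 'f) j. c * f j"
    by standard (auto simp: algebra_simps)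
  define e :: "'j \<Rightarrow> 'j \<Rightarrow> 'f" where "e i = (\<lambda>j. if j = i then 1 else 0)" for i
  \<comment> \<open>Extended by 0 outside \<open>J\<close>, so that the values lie in the span of
    the finitely many unit functions \<open>e i\<close> with \<open>i\<close> in
    \<open>J\<close>.\<close>
  define T where "T x = (\<lambda>j. if j \<in> J then l j x else 0)" for x
  interpret T: Vector_Spaces.linear scl "\<lambda>(c::'f) (f::'j \<Rightarrow> 'f) j. c * f j" T
  proof
    show "T (x + y) = T x + T y" for x y
      using lin by (auto simp: T_def fun_eq_iff Vector_Spaces.linear_iff)
    show "T (scl c x) = (\<lambda>j. c * T x j)" for c x
      using lin by (auto simp: T_def fun_eq_iff Vector_Spaces.linear_iff)
  qed
  have spanV: "vs.span C \<subseteq> V"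
    using C(2) V(1) by (metis vs.span_minimal vs.subspace_span)
  have inj: "inj_on T (vs.span C)"
    unfolding T.inj_on_iff_eq_0[OF vs.subspace_span]
  proof (intro ballI impI)
    fix x assume x: "x \<in> vs.span C" "T x = 0"
    then have "x \<in> W"
      using spanV by (intro ker) (auto simp: T_def fun_eq_iff split: if_splits)
    then show "x = 0" using x C(4) by blast
  qed
  have "fn.independent (T ` C)"
    by (rule T.independent_injective_image[OF C(3) inj])
  moreover have "T ` C \<subseteq> fn.span (e ` J)"
  proof
    fix f assume "f \<in> T ` C"
    moreover have sum_apply: "(\<Sum>i\<in>J. h i) j = (\<Sum>i\<in>J. h i j)" for h :: "'j \<Rightarrow> 'j \<Rightarrow> 'f" and j
      using J by (induction J) auto
    ultimately have "f = (\<Sum>i\<in>J. (\<lambda>j. f i * e i j))"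
      using J by (auto simp: T_def e_def fun_eq_iff sum_apply if_distrib cong: if_cong)
    also have "\<dots> \<in> fn.span (e ` J)"
      by (intro fn.span_sum fn.span_scale fn.span_base imageI)
    finally show "f \<in> fn.span (e ` J)" .
  qed
  ultimately have "card (T ` C) \<le> card (e ` J)"
    using fn.independent_span_bound[of "e ` J" "T ` C"] J by auto
  also have "\<dots> \<le> card J"
    by (rule card_image_le[OF J])
  also have "card (T ` C) = card C"
    using inj vs.span_superset by (metis card_image inj_on_subset)
  finally show ?thesis using dim by simp
qed

text \<open>The matrix \<open>l j (g i)\<close> is triangular for the strict order \<open>r\<close>
  with nonzero diagonal, and the functionals factor through the quotient, so the classes of the
  \<open>g j\<close> are linearly independent.\<close>

lemma dim_quotient_ge:
  fixes scl :: "'f::field \<Rightarrow> 'b \<Rightarrow> 'b::ab_group_add" and l :: "'j \<Rightarrow> 'b \<Rightarrow> 'f"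
  assumes vs: "vector_space scl" and W: "Modules.module.subspace scl W" "W \<subseteq> V"
    and V: "V = Modules.module.span scl B" "finite B"
    and J: "finite J" and lin: "\<And>j. j \<in> J \<Longrightarrow> Vector_Spaces.linear scl (*) (l j)"
    and van: "\<And>j x. j \<in> J \<Longrightarrow> x \<in> W \<Longrightarrow> l j x = 0"
    and g: "\<And>j. j \<in> J \<Longrightarrow> g j \<in> V" and diag: "\<And>j. j \<in> J \<Longrightarrow> l j (g j) \<noteq> 0"
    and tri: "\<And>i j. i \<in> J \<Longrightarrow> j \<in> J \<Longrightarrow> l j (g i) \<noteq> 0 \<Longrightarrow> i \<noteq> j \<Longrightarrow> (j, i) \<in> r"
    and r: "trans r" "irrefl r"
  shows "card J \<le> vectorspace.dim field_ring (quotient_module (subspace_module scl V) W)"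
proof -
  interpret vs: vector_space scl by (rule vs)
  obtain C where C: "finite C" "C \<subseteq> V" "vs.independent C" "vs.span C \<inter> W = {0}"
    and cover: "\<And>x. x \<in> V \<Longrightarrow> \<exists>y\<in>vs.span C. x - y \<in> W"
    and dim: "vectorspace.dim field_ring (quotient_module (subspace_module scl V) W) = card C"
    using quotient_complement_exists[OF vs W V] by metis
  have "\<forall>j\<in>J. \<exists>y\<in>vs.span C. g j - y \<in> W"
    using g cover by blast
  then obtain h where h: "\<And>j. j \<in> J \<Longrightarrow> h j \<in> vs.span C" "\<And>j. j \<in> J \<Longrightarrow> g j - h j \<in> W"
    by metis
  have lh: "l j (h i) = l j (g i)" if "i \<in> J" "j \<in> J" for i j
  proof -
    interpret l: Vector_Spaces.linear scl "(*)" "l j" using lin that by blast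
    have "l j (g i - h i) = 0" using van h that by blast
    then show ?thesis by (simp add: l.diff)
  qed
  have zero: "a i = 0" if a: "(\<Sum>i\<in>J. scl (a i) (h i)) = 0" and "i \<in> J" for a i
  proof (rule ccontr)
    assume "a i \<noteq> 0"
    \<comment> \<open>For an \<open>r\<close>-maximal index \<open>j\<close> among the nonzero
      coefficients, \<open>l j\<close> kills every other term of the relation.\<close>
    define S where "S = {i \<in> J. a i \<noteq> 0}"
    have "finite S" "S \<noteq> {}"
      using J that \<open>a i \<noteq> 0\<close> by (auto simp: S_def)
    moreover have "asymp_on S (\<lambda>x y. (x, y) \<in> r)" "transp_on S (\<lambda>x y. (x, y) \<in> r)"
      using r by (auto simp: asymp_on_def transp_on_def irrefl_def dest: transD)
    ultimately obtain j where j: "j \<in> S" "\<And>i. i \<in> S \<Longrightarrow> i \<noteq> j \<Longrightarrow> (j, i) \<notin> r"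
      using Finite_Set.bex_max_element[of S "\<lambda>x y. (x, y) \<in> r"] by blast
    then have jJ: "j \<in> J" by (simp add: S_def)
    interpret l: Vector_Spaces.linear scl "(*)" "l j" using lin jJ by blast
    have "0 = (\<Sum>i\<in>J. a i * l j (h i))"
      using arg_cong[OF a, of "l j"] by (simp add: l.sum l.scale)
    also have "\<dots> = (\<Sum>i\<in>{j}. a i * l j (h i))"
      using J jJ j tri[OF _ jJ] by (intro sum.mono_neutral_right) (auto simp: S_def lh)
    finally show False
      using j(1) jJ diag lh by (simp add: S_def)
  qed
  have inj: "inj_on h J"
  proof (rule inj_onI, rule ccontr)
    fix i j assume ij: "i \<in> J" "j \<in> J" "h i = h j" "i \<noteq> j"
    define a where "a k = (if k = i then 1 else if k = j then -1 else 0 :: 'f)" for k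
    have "(\<Sum>k\<in>J. scl (a k) (h k)) = (\<Sum>k\<in>{i, j}. scl (a k) (h k))"
      using J ij by (intro sum.mono_neutral_right) (auto simp: a_def)
    also have "\<dots> = 0" using ij by (simp add: a_def)
    finally have "a i = 0" using zero ij by blast
    then show False by (simp add: a_def)
  qed
  have "vs.independent (h ` J)"
  proof
    assume "vs.dependent (h ` J)"
    then obtain u v where u: "v \<in> h ` J" "u v \<noteq> 0" "(\<Sum>v\<in>h ` J. scl (u v) v) = 0"
      using vs.dependent_finite[of "h ` J"] J by auto
    then have "(\<Sum>i\<in>J. scl (u (h i)) (h i)) = 0"
      by (simp add: sum.reindex[OF inj])
    then show False using zero[of "u \<circ> h"] u by auto
  qed
  then have "card (h ` J) \<le> card C"
    using vs.independent_span_bound[OF C(1), of "h ` J"] h(1) by blast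
  then show ?thesis using dim inj by (simp add: card_image)
qed

section \<open>Multilinear polynomials\<close>

definition monomial :: "('t \<times> nat) list \<Rightarrow> ('t, 'f::field) gr_poly" where
  "monomial l = Poly_Mapping.single (FWord l) 1"

definition multilinear_words :: "nat \<Rightarrow> ('t \<times> nat) list set" where
  "multilinear_words n = {l. distinct (map snd l) \<and> snd ` set l = {1..n}}"

text \<open>The multiset form is insensitive to rearranging pieces of a word, as happens in the two
  monomials of \<open>trace_poly\<close>.\<close>

lemma multilinear_words_iff:
  "l \<in> multilinear_words n \<longleftrightarrow> mset (map snd l) = mset [1..<Suc n]"
proof -
  have "distinct (map snd l) \<and> snd ` set l = {1..n}" if "mset (map snd l) = mset [1..<Suc n]"
    using mset_eq_imp_distinct_iff[OF that] mset_eq_setD[OF that]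
    by (simp add: atLeastLessThanSuc_atLeastAtMost del: upt_Suc)
  moreover have "mset (map snd l) = mset [1..<Suc n]"
    if "distinct (map snd l)" "snd ` set l = {1..n}"
    using that set_eq_iff_mset_eq_distinct[of "map snd l" "[1..<Suc n]"]
    by (simp add: atLeastLessThanSuc_atLeastAtMost del: upt_Suc)
  ultimately show ?thesis
    unfolding multilinear_words_def by blast
qed

lemma length_multilinear_words: "l \<in> multilinear_words n \<Longrightarrow> length l = n"
  unfolding multilinear_words_iff by (metis diff_Suc_1 length_map length_upt size_mset)

lemma finite_multilinear_words: "finite (multilinear_words n :: ('t::finite \<times> nat) list set)"
proof (rule finite_subset)
  show "multilinear_words n \<subseteq> {l :: ('t \<times> nat) list. set l \<subseteq> UNIV \<times> {1..n} \<and> length l = n}"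
    by (auto simp: length_multilinear_words) (force simp: multilinear_words_def)+
qed (simp add: finite_lists_length_eq)

lemma prod_list_gr_var:
  "prod_list (map (\<lambda>k. gr_var (t k) (\<sigma> k)) ks) = monomial (map (\<lambda>k. (t k, \<sigma> k)) ks)"
  by (induction ks)
    (simp_all add: monomial_def gr_var_def mult_single plus_fword_def flip: single_one zero_fword_def)

lemma multilinear_polys_eq:
  "(multilinear_polys n :: ('t, 'f::field) gr_poly set) = Modules.module.span poly_scale (monomial ` multilinear_words n)"
proof -
  have "map (\<lambda>k. (t k, \<sigma> k)) [1..<Suc n] \<in> multilinear_words n" if "\<sigma> permutes {1..n}" for t \<sigma>
  proof -
    have "map snd (map (\<lambda>k. (t k, \<sigma> k)) [1..<Suc n]) = map \<sigma> [1..<Suc n]"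
      by (simp add: comp_def)
    moreover have "distinct (map \<sigma> [1..<Suc n])" "\<sigma> ` set [1..<Suc n] = {1..n}"
      using permutes_inj_on[OF that] permutes_image[OF that]
      by (simp_all add: distinct_map atLeastLessThanSuc_atLeastAtMost del: upt_Suc)
    ultimately show ?thesis
      unfolding multilinear_words_def by (metis (mono_tags, lifting) list.set_map mem_Collect_eq)
  qed
  moreover have "\<exists>t \<sigma>. l = map (\<lambda>k. (t k, \<sigma> k)) [1..<Suc n] \<and> \<sigma> permutes {1..n}"
    if l: "l \<in> multilinear_words n" for l :: "('t \<times> nat) list"
  proof -
    have len: "length l = n" by (rule length_multilinear_words[OF l])
    \<comment> \<open>The permutation is read off the word: list positions start at 0, and outside
      \<open>{1..n}\<close> it has to be the identity.\<close>
    define \<sigma> where "\<sigma> k = (if k \<in> {1..n} then snd (l ! (k - 1)) else k)" for k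
    have "bij_betw (\<lambda>i. map snd l ! i) {..<n} {1..n}"
      using l bij_betw_nth[of "map snd l" "{..<n}" "{1..n}"] by (simp add: multilinear_words_def len)
    moreover have "bij_betw (\<lambda>k. k - 1) {1..n} {..<n}"
      by (rule bij_betwI[where g = Suc]) auto
    ultimately have "bij_betw ((\<lambda>i. map snd l ! i) \<circ> (\<lambda>k. k - 1)) {1..n} {1..n}"
      by (rule bij_betw_trans[rotated])
    then have "bij_betw \<sigma> {1..n} {1..n}"
      by (rule bij_betw_cong[THEN iffD1, rotated]) (auto simp: \<sigma>_def len)
    then have "\<sigma> permutes {1..n}"
      by (rule bij_imp_permutes) (auto simp: \<sigma>_def)
    moreover have "l = map (\<lambda>k. (fst (l ! (k - 1)), \<sigma> k)) [1..<Suc n]"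
      by (rule nth_equalityI) (auto simp: \<sigma>_def len simp del: upt_Suc)
    ultimately show ?thesis
      by (intro exI[of _ "\<lambda>k. fst (l ! (k - 1))"] exI[of _ \<sigma>] conjI)
  qed
  ultimately have "{prod_list (map (\<lambda>k. gr_var (t k) (\<sigma> k)) [1..<Suc n]) | t \<sigma>. \<sigma> permutes {1..n}}
      = (monomial ` multilinear_words n :: ('t, 'f::field) gr_poly set)"
    unfolding prod_list_gr_var by blast
  then show ?thesis
    by (simp only: multilinear_polys_def)
qed

lemma linear_lookup: "Vector_Spaces.linear poly_scale (*) (\<lambda>f. Poly_Mapping.lookup f w :: 'f::field)"
proof -
  interpret P: vector_space "poly_scale :: 'f \<Rightarrow> ('w \<Rightarrow>\<^sub>0 'f) \<Rightarrow> _"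
    by (rule vector_space_poly_scale)
  show ?thesis
    by standard (simp_all add: lookup_add lookup_poly_scale algebra_simps)
qed

context graded_algebra
begin

lemma linear_substitute:
  fixes \<phi> :: "'x \<Rightarrow> 'a"
  shows "Vector_Spaces.linear poly_scale scl (substitute scl \<phi>)"
proof -
  interpret P: vector_space "poly_scale :: 'f \<Rightarrow> ('x fword \<Rightarrow>\<^sub>0 'f) \<Rightarrow> _"
    by (rule vector_space_poly_scale)
  have ext: "substitute scl \<phi> f =
      (\<Sum>w\<in>K. scl (Poly_Mapping.lookup f w) (nonempty_prod (map \<phi> (letters w))))"
    if "finite K" "Poly_Mapping.keys f \<subseteq> K" for K and f :: "'x fword \<Rightarrow>\<^sub>0 'f"
    unfolding substitute_def using that
    by (intro sum.mono_neutral_left) (auto simp: in_keys_iff)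
  show ?thesis
  proof
    show "substitute scl \<phi> (f + g) = substitute scl \<phi> f + substitute scl \<phi> g" for f g
      using Poly_Mapping.keys_add[of f g]
      by (simp add: ext[of "Poly_Mapping.keys f \<union> Poly_Mapping.keys g"] lookup_add
          scale_left_distrib sum.distrib)
    have "Poly_Mapping.keys (poly_scale c f) \<subseteq> Poly_Mapping.keys f" for c and f :: "'x fword \<Rightarrow>\<^sub>0 'f"
      by (auto simp: in_keys_iff lookup_poly_scale)
    then show "substitute scl \<phi> (poly_scale c f) = scl c (substitute scl \<phi> f)" for c f
      by (simp add: ext[of "Poly_Mapping.keys f"] lookup_poly_scale scale_sum_right)
  qed
qed

lemma substitute_monomial: "substitute scl \<phi> (monomial l) = nonempty_prod (map \<phi> l)"
  by (simp add: substitute_def monomial_def)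

lemma substitute_cong_multilinear:
  fixes f :: "('t, 'f) gr_poly"
  assumes f: "f \<in> multilinear_polys n"
    and eq: "\<And>t i. i \<in> {1..n} \<Longrightarrow> \<phi> (t, i) = \<phi>' (t, i)"
  shows "substitute scl \<phi> f = substitute scl \<phi>' f"
proof -
  interpret P: vector_space_pair "poly_scale :: 'f \<Rightarrow> ('t, 'f) gr_poly \<Rightarrow> _" scl
    using vector_space_poly_scale vector_space_axioms by (intro vector_space_pair.intro)
  show ?thesis
  proof (rule P.linear_eq_on[OF linear_substitute linear_substitute])
    show "f \<in> P.vs1.span (monomial ` multilinear_words n)"
      using f by (simp add: multilinear_polys_eq)
    fix g :: "('t, 'f) gr_poly" assume "g \<in> monomial ` multilinear_words n"
    then show "substitute scl \<phi> g = substitute scl \<phi>' g"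
      by (force simp: substitute_monomial multilinear_words_def
          intro!: arg_cong[of _ _ nonempty_prod] eq)
  qed
qed

lemma nonempty_prod_sum:
  "nonempty_prod (xs @ (\<Sum>b\<in>B. scl (c b) (y b)) # ys) = (\<Sum>b\<in>B. scl (c b) (nonempty_prod (xs @ y b # ys)))"
proof (induction xs)
  case Nil
  show ?case
    by (cases ys) (simp_all add: sum_distrib_right scale_mult_left)
next
  case (Cons x xs)
  have "nonempty_prod (x # xs @ z # ys) = x * nonempty_prod (xs @ z # ys)" for z
    by (cases xs) auto
  then show ?case
    by (simp add: Cons sum_distrib_left scale_mult_right)
qed

text \<open>Index \<open>i\<close> occurs exactly once in every multilinear monomial, so the value
  is linear in what is put there. The degree attached to \<open>i\<close> varies with the monomial;
  therefore the coefficients \<open>c\<close> are common to all degrees.\<close>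

lemma substitute_sum_at:
  fixes f :: "('t, 'f) gr_poly"
  assumes f: "f \<in> multilinear_polys n" and i: "i \<in> {1..n}"
    and \<phi>: "\<And>t. \<phi> (t, i) = (\<Sum>b\<in>B. scl (c b) (\<psi> b t))"
  shows "substitute scl \<phi> f =
    (\<Sum>b\<in>B. scl (c b) (substitute scl (\<lambda>(t, k). if k = i then \<psi> b t else \<phi> (t, k)) f))"
proof -
  interpret P: vector_space_pair "poly_scale :: 'f \<Rightarrow> ('t, 'f) gr_poly \<Rightarrow> _" scl
    using vector_space_poly_scale vector_space_axioms by (intro vector_space_pair.intro)
  show ?thesis
  proof (rule P.linear_eq_on[OF linear_substitute])
    show "f \<in> P.vs1.span (monomial ` multilinear_words n)"
      using f by (simp add: multilinear_polys_eq)
    show "Vector_Spaces.linear poly_scale scl (\<lambda>f. \<Sum>b\<in>B. scl (c b)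
        (substitute scl (\<lambda>(t, k). if k = i then \<psi> b t else \<phi> (t, k)) f))"
      by (intro P.linear_compose_sum ballI P.linear_compose_scale_right linear_substitute)
    fix g :: "('t, 'f) gr_poly" assume "g \<in> monomial ` multilinear_words n"
    then obtain l where l: "l \<in> multilinear_words n" "g = monomial l" by auto
    then have "i \<in> snd ` set l" "distinct (map snd l)"
      using i by (auto simp: multilinear_words_def)
    then obtain xs ys t where split: "l = xs @ (t, i) # ys" and nin: "i \<notin> snd ` set xs" "i \<notin> snd ` set ys"
      by (fastforce dest: split_list)
    have same: "map (\<lambda>(t, k). if k = i then h t else \<phi> (t, k)) zs = map \<phi> zs" if "i \<notin> snd ` set zs" for h zs
      using that by (force intro!: map_cong)
    show "substitute scl \<phi> g =
        (\<Sum>b\<in>B. scl (c b) (substitute scl (\<lambda>(t, k). if k = i then \<psi> b t else \<phi> (t, k)) g))"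
      by (simp add: l(2) split substitute_monomial \<phi> nonempty_prod_sum same[OF nin(1)] same[OF nin(2)])
  qed
qed

text \<open>By multilinearity, general values can be replaced by basis values one index at a
  time.\<close>

lemma substitute_eq_0I:
  fixes f :: "('t, 'f) gr_poly"
  assumes f: "f \<in> multilinear_polys n" and "B \<noteq> {}"
    and expand: "\<And>i. i \<in> {1..n} \<Longrightarrow> \<exists>c. \<forall>t. \<phi> (t, i) = (\<Sum>b\<in>B. scl (c b) (\<psi> b t))"
    and zero: "\<And>a. a \<in> {1..n} \<rightarrow>\<^sub>E B \<Longrightarrow> substitute scl (\<lambda>(t, i). \<psi> (a i) t) f = 0"
  shows "substitute scl \<phi> f = 0"
proof -
  \<comment> \<open>Indices in \<open>S\<close> carry general values, the others basis values;
    enlarging \<open>S\<close> expands one more index.\<close>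
  have part: "substitute scl (\<lambda>(t, i). if i \<in> S then \<phi> (t, i) else \<psi> (a i) t) f = 0"
    if "finite S" "S \<subseteq> {1..n}" "a \<in> {1..n} \<rightarrow> B" for S a
    using that
  proof (induction S arbitrary: a rule: finite_induct)
    case empty
    have "substitute scl (\<lambda>(t, i). \<psi> (a i) t) f
        = substitute scl (\<lambda>(t, i). \<psi> (restrict a {1..n} i) t) f"
      by (rule substitute_cong_multilinear[OF f]) auto
    also have "\<dots> = 0"
      using empty by (intro zero) auto
    finally show ?case by simp
  next
    case (insert i S)
    have i: "i \<in> {1..n}" using insert by auto
    then obtain c where c: "\<And>t. \<phi> (t, i) = (\<Sum>b\<in>B. scl (c b) (\<psi> b t))"
      using expand by metis
    have "substitute scl (\<lambda>(t, k). if k = i then \<psi> b t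
          else (\<lambda>(t, i'). if i' \<in> insert i S then \<phi> (t, i') else \<psi> (a i') t) (t, k)) f = 0"
      if "b \<in> B" for b
    proof -
      have "(\<lambda>(t, k). if k = i then \<psi> b t
          else (\<lambda>(t, i'). if i' \<in> insert i S then \<phi> (t, i') else \<psi> (a i') t) (t, k))
        = (\<lambda>(t, k). if k \<in> S then \<phi> (t, k) else \<psi> ((a(i := b)) k) t)"
        using insert.hyps by (auto simp: fun_eq_iff)
      then show ?thesis
        using insert.IH[of "a(i := b)"] insert.prems that by (auto simp: Pi_iff)
    qed
    then show ?case
      using substitute_sum_at[OF f i, of "\<lambda>(t, k). if k \<in> insert i S then \<phi> (t, k) else \<psi> (a k) t" c \<psi> B]
      by (simp add: c cong: sum.cong)
  qed
  have "substitute scl \<phi> f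
      = substitute scl (\<lambda>(t, i). if i \<in> {1..n} then \<phi> (t, i) else \<psi> (a i) t) f" for a
    by (rule substitute_cong_multilinear[OF f]) auto
  moreover obtain a where "a \<in> {1..n} \<rightarrow> B"
    using \<open>B \<noteq> {}\<close> by fastforce
  ultimately show ?thesis
    using part[of "{1..n}" a] by simp
qed

end

section \<open>The upper bound\<close>

fun mat_prod :: "('f::field^2^2) list \<Rightarrow> 'f^2^2" where
  "mat_prod [] = mat 1"
| "mat_prod (x # xs) = x ** mat_prod xs"

lemma mat_prod_append: "mat_prod (xs @ ys) = mat_prod xs ** mat_prod ys"
  by (induction xs) (simp_all add: matrix_mul_assoc)

lemma mat_mult_0 [simp]: "(0 :: 'f::field^2^2) ** x = 0" "x ** (0 :: 'f^2^2) = 0"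
  by (simp_all add: matrix_matrix_mult_def vec_eq_iff)

lemma mat_prod_eq_0: "0 \<in> set xs \<Longrightarrow> mat_prod xs = 0"
  by (induction xs) auto

lemma mat_unit_mult_nth: "(mat_unit i j ** M) $ p $ q = (if p = i then M $ j $ q else (0 :: 'f::field))"
  using exhaust_2[of j] by (auto simp: mat_unit_def matrix_matrix_mult_def sum_2)

lemma mat_part_nonempty_prod:
  "xs \<noteq> [] \<Longrightarrow> mat_part (nonempty_prod xs) = mat_prod (map mat_part xs)"
  by (induction xs rule: nonempty_prod.induct) (simp_all add: times_A2_def)

lemma nil_part_nonempty_prod: "length xs \<ge> 2 \<Longrightarrow> nil_part (nonempty_prod xs) = 0"
  by (cases xs rule: nonempty_prod.cases) (auto simp: times_A2_def)

interpretation A2: graded_algebra "A2_scale :: 'f::field \<Rightarrow> 'f A2 \<Rightarrow> 'f A2" A2_grading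
  by (rule graded_algebra_A2)

lemma vector_space_times: "vector_space ((*) :: 'f::field \<Rightarrow> 'f \<Rightarrow> 'f)"
  by standard (auto simp: algebra_simps)

lemma linear_mat_part: "Vector_Spaces.linear A2_scale (*) (\<lambda>x :: 'f::field A2. mat_part x $ p $ q)"
proof -
  interpret vector_space "(*) :: 'f \<Rightarrow> 'f \<Rightarrow> 'f"
    by (rule vector_space_times)
  show ?thesis
    by standard (auto simp: plus_A2_def A2_scale_def)
qed

lemma linear_entry:
  "Vector_Spaces.linear poly_scale (*) (\<lambda>f. mat_part (substitute A2_scale \<phi> f) $ p $ q :: 'f::field)"
  using Vector_Spaces.linear_compose[OF A2.linear_substitute linear_mat_part]
  by (simp add: comp_def)

lemma entry_monomial:
  "l \<noteq> [] \<Longrightarrow> mat_part (substitute A2_scale \<phi> (monomial l)) = mat_prod (map (\<lambda>x. mat_part (\<phi> x)) l)"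
  by (simp add: A2.substitute_monomial mat_part_nonempty_prod comp_def)

section \<open>Homogeneous basis elements and their weights\<close>

instance T2 :: finite
proof
  have "UNIV = {T2_zero, T2_v}"
    by (auto intro: T2.exhaust)
  then show "finite (UNIV :: T2 set)"
    by (metis finite.simps)
qed

text \<open>The matrix units as steps of the walk of partial weights. \<open>Stay\<close> and
  \<open>Inner\<close> both keep the height; \<open>Inner\<close> is the one that continues an open
  block.\<close>

datatype step = Up | Stay | Inner | Down

fun step_unit :: "step \<Rightarrow> 'f::field^2^2" where
  "step_unit Up = mat_unit 1 2"
| "step_unit Stay = mat_unit 1 1"
| "step_unit Inner = mat_unit 2 2"
| "step_unit Down = mat_unit 2 1"

fun step_weight :: "step \<Rightarrow> int" where
  "step_weight Up = 1"
| "step_weight Stay = 0"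
| "step_weight Inner = 0"
| "step_weight Down = - 1"

text \<open>No element of degree \<open>T2_v\<close> has matrix part e21: the pair
  \<open>(Down, T2_v)\<close> gets the default value 0 and is excluded from
  \<open>graded_steps\<close>.\<close>

fun basis_elt :: "step \<times> T2 \<Rightarrow> 'f::field A2" where
  "basis_elt (s, T2_zero) = A2 (step_unit s) 0"
| "basis_elt (Up, T2_v) = A2 (step_unit Up) (0, 1, 0)"
| "basis_elt (Stay, T2_v) = A2 (step_unit Stay) (1, 0, 0)"
| "basis_elt (Inner, T2_v) = A2 (step_unit Inner) (0, 0, 1)"
| "basis_elt (Down, T2_v) = 0"

definition graded_steps :: "(step \<times> T2) set" where
  "graded_steps = - {(Down, T2_v)}"

text \<open>A letter fixes a degree together with a basis element, and a variable of the other
  degree gets 0. So one letter per index determines a graded substitution and singles out the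
  monomials with these degrees.\<close>

definition eval_step :: "step \<times> T2 \<Rightarrow> T2 \<Rightarrow> 'f::field A2" where
  "eval_step b t = (if snd b = t then basis_elt b else 0)"

lemma graded_steps_eq: "graded_steps =
  {(Up, T2_zero), (Stay, T2_zero), (Inner, T2_zero), (Down, T2_zero), (Up, T2_v), (Stay, T2_v), (Inner, T2_v)}"
proof -
  have "b \<in> graded_steps \<longleftrightarrow> b \<in> {(Up, T2_zero), (Stay, T2_zero), (Inner, T2_zero), (Down, T2_zero),
      (Up, T2_v), (Stay, T2_v), (Inner, T2_v)}" for b
    by (cases "fst b"; cases "snd b"; cases b) (simp_all add: graded_steps_def)
  then show ?thesis by blast
qed

lemma mat_part_basis_elt: "b \<in> graded_steps \<Longrightarrow> mat_part (basis_elt b) = step_unit (fst b)"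
  by (cases b rule: basis_elt.cases) (auto simp: graded_steps_def)

lemma eval_step_in_grading: "eval_step b t \<in> A2_grading t"
proof (cases "snd b = t \<and> b \<in> graded_steps")
  case True
  then show ?thesis
    by (auto simp: graded_steps_eq eval_step_def intro!: A2.span_base)
next
  case False
  then have "eval_step b t = (0 :: 'a A2)"
    by (auto simp: eval_step_def graded_steps_def)
  then show ?thesis
    using A2.subspace_0[OF A2.subspace_gr] by simp
qed

text \<open>Only letters of degree \<open>t\<close> contribute at \<open>t\<close>, so the
  coordinates of the values in both degrees combine into a single coefficient function.\<close>

lemma grading_expand:
  fixes x :: "T2 \<Rightarrow> 'f::field A2"
  assumes "\<And>t. x t \<in> A2_grading t"
  shows "\<exists>c. \<forall>t. x t = (\<Sum>b\<in>graded_steps. A2_scale (c b) (eval_step b t))"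
proof -
  obtain m where m: "x T2_zero = A2 m 0"
    using assms[of T2_zero] by auto
  obtain a b d where v: "x T2_v = A2_scale a (basis_elt (Stay, T2_v)) + A2_scale b (basis_elt (Up, T2_v))
      + A2_scale d (basis_elt (Inner, T2_v))"
    using assms[of T2_v] by (auto simp: A2.span_breakdown_eq algebra_simps)
  define c where "c = (\<lambda>s. case s of
      (Up, T2_zero) \<Rightarrow> m $ 1 $ 2 | (Stay, T2_zero) \<Rightarrow> m $ 1 $ 1
    | (Inner, T2_zero) \<Rightarrow> m $ 2 $ 2 | (Down, T2_zero) \<Rightarrow> m $ 2 $ 1
    | (Up, T2_v) \<Rightarrow> b | (Stay, T2_v) \<Rightarrow> a | (Inner, T2_v) \<Rightarrow> d | (Down, T2_v) \<Rightarrow> 0)"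
  have "x t = (\<Sum>b\<in>graded_steps. A2_scale (c b) (eval_step b t))" for t
  proof (cases t)
    case T2_zero
    then show ?thesis
      by (simp add: graded_steps_eq eval_step_def c_def m zero_A2_def plus_A2_def A2_scale_def
          mat_unit_def vec_eq_iff forall_2 zero_prod_def)
  next
    case T2_v
    then show ?thesis
      by (simp add: graded_steps_eq eval_step_def c_def v zero_A2_def plus_A2_def A2_scale_def
          mat_unit_def vec_eq_iff forall_2 zero_prod_def)
  qed
  then show ?thesis by blast
qed

text \<open>The weight of a matrix unit is a function of its column index minus the same function of
  its row index, so the sum telescopes along a nonzero product.\<close>

lemma mat_prod_weight:
  assumes "\<And>x. x \<in> set xs \<Longrightarrow> f x = step_unit (s x) \<or> f x = 0"
    and "mat_prod (map f xs) $ p $ q \<noteq> (0 :: 'f::field)"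
  shows "(\<Sum>x\<leftarrow>xs. step_weight (s x)) = of_bool (q = 2) - of_bool (p = 2)"
  using assms
proof (induction xs arbitrary: p)
  case Nil
  then show ?case by (simp add: mat_def split: if_splits)
next
  case (Cons x xs)
  have "f x = step_unit (s x)"
    using Cons.prems by force
  then obtain i j where ij: "f x = mat_unit i j"
    "step_weight (s x) = of_bool (j = 2) - of_bool (i = 2)"
    by (cases "s x") auto
  then have "p = i" "mat_prod (map f xs) $ j $ q \<noteq> 0"
    using Cons.prems(2) by (auto simp: mat_unit_mult_nth split: if_splits)
  then show ?case
    using Cons.IH[of j] Cons.prems(1) ij by simp
qed

definition eval_at :: "(nat \<Rightarrow> step \<times> T2) \<Rightarrow> T2 \<times> nat \<Rightarrow> 'f::field A2" where
  "eval_at a = (\<lambda>(t, i). eval_step (a i) t)"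

lemma mat_part_eval_at:
  "a i \<in> graded_steps \<Longrightarrow> mat_part (eval_at a (t, i)) = (if snd (a i) = t then step_unit (fst (a i)) else 0)"
  by (auto simp: eval_at_def eval_step_def mat_part_basis_elt zero_A2_def)

text \<open>Every multilinear monomial uses each index once, so all of them have the same total
  weight; in a nonzero product it is at most 1 in absolute value.\<close>

lemma entry_eq_0_if_weight:
  fixes f :: "(T2, 'f::field) gr_poly"
  assumes f: "f \<in> multilinear_polys n" and n: "n \<ge> 1" and a: "a \<in> {1..n} \<rightarrow> graded_steps"
    and w: "1 < \<bar>\<Sum>i\<in>{1..n}. step_weight (fst (a i))\<bar>"
  shows "mat_part (substitute A2_scale (eval_at a) f) $ p $ q = 0"
proof -
  interpret P: vector_space_pair "poly_scale :: 'f \<Rightarrow> (T2, 'f) gr_poly \<Rightarrow> _" "(*) :: 'f \<Rightarrow> 'f \<Rightarrow> 'f"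
    using vector_space_poly_scale vector_space_times by (intro vector_space_pair.intro)
  show ?thesis
  proof (rule P.linear_eq_0_on_span[OF linear_entry])
    show "f \<in> P.vs1.span (monomial ` multilinear_words n)"
      using f by (simp add: multilinear_polys_eq)
    fix g :: "(T2, 'f) gr_poly" assume "g \<in> monomial ` multilinear_words n"
    then obtain l where l: "l \<in> multilinear_words n" and g: "g = monomial l"
      by auto
    have ne: "l \<noteq> []" using length_multilinear_words[OF l] n by auto
    have "mat_prod (map (\<lambda>x. mat_part (eval_at a x)) l) $ p $ q = (0 :: 'f)"
    proof (rule ccontr)
      assume nz: "\<not> ?thesis"
      have "mat_part (eval_at a x) = (step_unit (fst (a (snd x))) :: 'f^2^2) \<or> mat_part (eval_at a x) = (0 :: 'f^2^2)"
        if "x \<in> set l" for x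
      proof (cases x)
        case (Pair t i)
        then have "a i \<in> graded_steps" using that l a by (force simp: multilinear_words_def)
        then show ?thesis by (simp add: Pair mat_part_eval_at)
      qed
      from mat_prod_weight[OF this nz]
      have "(\<Sum>x\<leftarrow>l. step_weight (fst (a (snd x)))) = of_bool (q = 2) - of_bool (p = 2)" by simp
      moreover have "(\<Sum>x\<leftarrow>l. step_weight (fst (a (snd x)))) = (\<Sum>i\<in>{1..n}. step_weight (fst (a i)))"
        using l sum_list_distinct_conv_sum_set[of "map snd l" "\<lambda>i. step_weight (fst (a i))"]
        by (simp add: multilinear_words_def comp_def)
      ultimately show False using w by (cases "q = 2"; cases "p = 2") auto
    qed
    then show "mat_part (substitute A2_scale (eval_at a) g) $ p $ q = 0"
      by (simp add: g entry_monomial[OF ne])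
  qed
qed

lemma nil_part_substitute:
  fixes f :: "(T2, 'f::field) gr_poly"
  assumes f: "f \<in> multilinear_polys n" and n: "n \<ge> 2"
  shows "nil_part (substitute A2_scale \<phi> f) = 0"
proof -
  interpret P: vector_space_pair "poly_scale :: 'f \<Rightarrow> (T2, 'f) gr_poly \<Rightarrow> _" "A2_scale :: 'f \<Rightarrow> 'f A2 \<Rightarrow> 'f A2"
    using vector_space_poly_scale A2.vector_space_axioms by (intro vector_space_pair.intro)
  interpret S: Vector_Spaces.linear poly_scale "A2_scale :: 'f \<Rightarrow> 'f A2 \<Rightarrow> 'f A2" "substitute A2_scale \<phi>"
    by (rule A2.linear_substitute)
  have "f \<in> P.vs1.span (monomial ` multilinear_words n)"
    using f by (simp add: multilinear_polys_eq)
  then show ?thesis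
  proof (induction rule: P.vs1.span_induct_alt)
    case base
    then show ?case by (simp add: S.zero zero_A2_def)
  next
    case (step c g h)
    then obtain l where l: "l \<in> multilinear_words n" and g: "g = monomial l"
      by auto
    have "nil_part (substitute A2_scale \<phi> g) = 0"
      using length_multilinear_words[OF l] n
      by (simp add: g A2.substitute_monomial nil_part_nonempty_prod)
    moreover have "nil_part (A2_scale c x + y) = 0" if "nil_part x = 0" "nil_part y = 0" for x y :: "'f A2"
      using that by (simp add: plus_A2_def A2_scale_def zero_prod_def)
    ultimately show ?case
      using step.IH by (simp only: S.add S.scale)
  qed
qed

lemma lookup_0_multilinear:
  fixes f :: "('t, 'f::field) gr_poly"
  assumes f: "f \<in> multilinear_polys n" and n: "n \<ge> 1"
  shows "Poly_Mapping.lookup f 0 = 0"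
proof -
  interpret P: vector_space_pair "poly_scale :: 'f \<Rightarrow> ('t, 'f) gr_poly \<Rightarrow> _" "(*) :: 'f \<Rightarrow> 'f \<Rightarrow> 'f"
    using vector_space_poly_scale vector_space_times by (intro vector_space_pair.intro)
  show ?thesis
  proof (rule P.linear_eq_0_on_span[OF linear_lookup])
    show "f \<in> P.vs1.span (monomial ` multilinear_words n)"
      using f by (simp add: multilinear_polys_eq)
    fix g :: "('t, 'f) gr_poly" assume "g \<in> monomial ` multilinear_words n"
    then show "Poly_Mapping.lookup g 0 = 0"
      using n length_multilinear_words by (fastforce simp: monomial_def lookup_single zero_fword_def when_def)
  qed
qed

text \<open>The functionals are the four matrix entries at each substitution of basis elements of
  small weight. The entries at large weight vanish automatically, and so do the nil parts because
  \<open>n\<close> is at least 2.\<close>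

lemma graded_codim_le:
  assumes n: "n \<ge> 2"
  shows "graded_codim (A2_scale :: 'f::field \<Rightarrow> 'f A2 \<Rightarrow> 'f A2) A2_grading n
    \<le> 4 * card {a \<in> {1..n} \<rightarrow>\<^sub>E graded_steps. \<bar>\<Sum>i\<in>{1..n}. step_weight (fst (a i))\<bar> \<le> 1}"
proof -
  interpret P: vector_space "poly_scale :: 'f \<Rightarrow> (T2, 'f) gr_poly \<Rightarrow> _"
    by (rule vector_space_poly_scale)
  let ?V = "multilinear_polys n :: (T2, 'f) gr_poly set"
  let ?I = "graded_identities (A2_scale :: 'f \<Rightarrow> 'f A2 \<Rightarrow> 'f A2) A2_grading"
  define S where "S = {a \<in> {1..n} \<rightarrow>\<^sub>E graded_steps. \<bar>\<Sum>i\<in>{1..n}. step_weight (fst (a i))\<bar> \<le> 1}"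
  define l :: "_ \<Rightarrow> (T2, 'f) gr_poly \<Rightarrow> 'f"
    where "l = (\<lambda>(a, p, q) f. mat_part (substitute A2_scale (eval_at a) f) $ p $ q)"
  have "finite S"
    by (auto simp: S_def graded_steps_eq intro!: finite_PiE intro: finite_subset[of _ "{1..n} \<rightarrow>\<^sub>E graded_steps"])
  have "vectorspace.dim field_ring (quotient_module (subspace_module poly_scale ?V) (?V \<inter> ?I))
      \<le> card (S \<times> (UNIV :: 2 set) \<times> (UNIV :: 2 set))"
  proof (rule dim_quotient_le[OF vector_space_poly_scale _ _ multilinear_polys_eq])
    show "P.subspace (?V \<inter> ?I)"
      by (intro P.subspace_inter A2.subspace_graded_identities) (simp add: multilinear_polys_def)
    show "finite (S \<times> (UNIV :: 2 set) \<times> (UNIV :: 2 set))"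
      using \<open>finite S\<close> by simp
    show "Vector_Spaces.linear poly_scale (*) (l j)" for j
      by (auto simp: l_def case_prod_unfold intro: linear_entry)
    fix f assume f: "f \<in> ?V" and z: "\<And>j. j \<in> S \<times> UNIV \<times> UNIV \<Longrightarrow> l j f = 0"
    have "substitute A2_scale \<phi> f = 0" if \<phi>: "\<forall>t i. \<phi> (t, i) \<in> A2_grading t" for \<phi>
    proof (rule A2.substitute_eq_0I[OF f])
      show "\<exists>c. \<forall>t. \<phi> (t, i) = (\<Sum>b\<in>graded_steps. A2_scale (c b) (eval_step b t))" for i
        using grading_expand[of "\<lambda>t. \<phi> (t, i)"] \<phi> by blast
      fix a assume a: "a \<in> {1..n} \<rightarrow>\<^sub>E graded_steps"
      have "mat_part (substitute A2_scale (eval_at a) f) $ p $ q = 0" for p q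
      proof (cases "a \<in> S")
        case True
        then show ?thesis using z[of "(a, p, q)"] by (simp add: l_def)
      next
        case False
        then show ?thesis
          using a n by (intro entry_eq_0_if_weight[OF f]) (auto simp: S_def)
      qed
      then have "substitute A2_scale (eval_at a) f = 0"
        using nil_part_substitute[OF f n] by (auto simp: zero_A2_def vec_eq_iff intro!: A2.expand)
      then show "substitute A2_scale (\<lambda>(t, i). eval_step (a i) t) f = 0"
        by (simp add: eval_at_def)
    qed (simp add: graded_steps_eq)
    then show "f \<in> ?V \<inter> ?I"
      using f lookup_0_multilinear[OF f] n by (simp add: graded_identities_def)
  qed (use finite_multilinear_words in auto)
  then show ?thesis
    by (simp add: graded_codim_def S_def card_cartesian_product)
qed

text \<open>With \<open>0 < z \<le> 1\<close>, a weight of at most 1 gives \<open>z\<close> to that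
  weight at least \<open>z\<close>, so each counted assignment is majorised by
  \<open>1 / z = sqrt 2\<close> times its term in the generating function.\<close>

lemma card_bounded_weight_le:
  "real (card {a \<in> {1..n} \<rightarrow>\<^sub>E graded_steps. \<bar>\<Sum>i\<in>{1..n}. step_weight (fst (a i))\<bar> \<le> 1})
    \<le> sqrt 2 * (4 + 2 * sqrt 2) ^ n" (is "real (card ?S) \<le> _")
proof -
  define z :: real where "z = 1 / sqrt 2"
  have z: "0 < z" "z \<le> 1" by (auto simp: z_def)
  have fin: "finite ({1..n} \<rightarrow>\<^sub>E graded_steps)"
    by (auto simp: graded_steps_eq intro!: finite_PiE)
  have "real (card ?S) = (\<Sum>a\<in>?S. 1)" by simp
  also have "\<dots> \<le> (\<Sum>a\<in>?S. sqrt 2 * (\<Prod>i\<in>{1..n}. z powi step_weight (fst (a i))))"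
  proof (rule sum_mono)
    fix a assume a: "a \<in> ?S"
    have "(\<Prod>i\<in>{1..n}. z powi step_weight (fst (a i))) = z powi (\<Sum>i\<in>{1..n}. step_weight (fst (a i)))"
      using z by (induction n) (simp_all add: power_int_add)
    also have "\<dots> \<ge> z"
      using a power_int_decreasing[of "\<Sum>i\<in>{1..n}. step_weight (fst (a i))" 1 z] z by auto
    finally have "(\<Prod>i\<in>{1..n}. z powi step_weight (fst (a i))) \<ge> 1 / sqrt 2"
      by (simp add: z_def)
    then show "1 \<le> sqrt 2 * (\<Prod>i\<in>{1..n}. z powi step_weight (fst (a i)))"
      by (simp add: field_simps)
  qed
  also have "\<dots> \<le> (\<Sum>a\<in>{1..n} \<rightarrow>\<^sub>E graded_steps. sqrt 2 * (\<Prod>i\<in>{1..n}. z powi step_weight (fst (a i))))"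
    using fin z by (intro sum_mono2) (auto intro!: mult_nonneg_nonneg prod_nonneg)
  \<comment> \<open>The sum over all assignments factorises over the indices; each factor is
    \<open>4 + 2 * z + 1 / z\<close>.\<close>
  also have "\<dots> = sqrt 2 * (\<Prod>i\<in>{1..n}. \<Sum>b\<in>graded_steps. z powi step_weight (fst b))"
    by (subst prod_sum_PiE) (auto simp: graded_steps_eq sum_distrib_left)
  also have "(\<Sum>b\<in>graded_steps. z powi step_weight (fst b)) = 4 + 2 * sqrt 2"
    by (simp add: graded_steps_eq z_def power_int_minus field_simps)
  finally show ?thesis by simp
qed

section \<open>The lower bound\<close>

text \<open>The number \<open>h\<close> is the height before the word, i.e. the number of blocks
  already open; all of them have to be closed by the end.\<close>

fun admissible :: "step list \<Rightarrow> nat \<Rightarrow> bool" where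
  "admissible [] h \<longleftrightarrow> h = 0"
| "admissible (Up # w) h \<longleftrightarrow> admissible w (Suc h)"
| "admissible (Stay # w) h \<longleftrightarrow> admissible w h"
| "admissible (Inner # w) h \<longleftrightarrow> h > 0 \<and> admissible w h"
| "admissible (Down # w) h \<longleftrightarrow> h > 0 \<and> admissible w (h - 1)"

text \<open>
  The blocks of a word in the variables \<open>xs\<close>: \<open>Up\<close> opens a block, \<open>Inner\<close> continues and \<open>Down\<close>
  closes the block opened last, and \<open>Stay\<close> forms a block by itself.  The third argument is the
  stack of open blocks.
\<close>

fun blocks :: "step list \<Rightarrow> 'x list \<Rightarrow> 'x list list \<Rightarrow> 'x list list" where
  "blocks (Up # w) (x # xs) st = blocks w xs ([x] # st)"
| "blocks (Stay # w) (x # xs) st = [x] # blocks w xs st"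
| "blocks (Inner # w) (x # xs) (b # st) = blocks w xs ((b @ [x]) # st)"
| "blocks (Down # w) (x # xs) (b # st) = (b @ [x]) # blocks w xs st"
| "blocks _ _ st = st"

text \<open>With the height tied to the length of the stack, the stack is nonempty at
  \<open>Inner\<close> and \<open>Down\<close> and empty at the end, so the catch-all equation of
  \<open>blocks\<close> is met only at the end of the word.\<close>

lemma valid_blocks_induct [consumes 2, case_names Nil Up Stay Inner Down]:
  assumes "admissible w (length st)" "length w = length xs"
    and "P [] [] []"
    and "\<And>w x xs st. admissible w (Suc (length st)) \<Longrightarrow> length w = length xs \<Longrightarrow> P w xs ([x] # st) \<Longrightarrow> P (Up # w) (x # xs) st"
    and "\<And>w x xs st. admissible w (length st) \<Longrightarrow> length w = length xs \<Longrightarrow> P w xs st \<Longrightarrow> P (Stay # w) (x # xs) st"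
    and "\<And>w x xs b st. admissible w (Suc (length st)) \<Longrightarrow> length w = length xs \<Longrightarrow> P w xs ((b @ [x]) # st)
      \<Longrightarrow> P (Inner # w) (x # xs) (b # st)"
    and "\<And>w x xs b st. admissible w (length st) \<Longrightarrow> length w = length xs \<Longrightarrow> P w xs st
      \<Longrightarrow> P (Down # w) (x # xs) (b # st)"
  shows "P w xs st"
  using assms(1,2)
proof (induction w arbitrary: xs st)
  case Nil
  then show ?case using assms(3) by simp
next
  case (Cons s w)
  then obtain x xs' where xs: "xs = x # xs'" by (cases xs) auto
  show ?case
  proof (cases s)
    case Up
    then show ?thesis using Cons assms(4)[of w st xs' x] xs by simp
  next
    case Stay
    then show ?thesis using Cons assms(5)[of w st xs' x] xs by simp
  next
    case Inner
    then obtain b st' where "st = b # st'" using Cons.prems by (cases st) auto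
    then show ?thesis using Inner Cons assms(6)[of w st' xs' b x] xs by simp
  next
    case Down
    then obtain b st' where "st = b # st'" using Cons.prems by (cases st) auto
    then show ?thesis using Down Cons assms(7)[of w st' xs' x b] xs by simp
  qed
qed

text \<open>Every variable enters exactly one block, which makes the polynomials built from the
  blocks multilinear.\<close>

lemma mset_concat_blocks:
  assumes "admissible w (length st)" "length w = length xs"
  shows "mset (concat (blocks w xs st)) = mset xs + mset (concat st)"
  using assms by (induction rule: valid_blocks_induct) auto

text \<open>An open block is only ever extended at its right end.\<close>

lemma blocks_extend_stack:
  assumes "admissible w (length st)" "length w = length xs" "b \<in> set st"
  shows "\<exists>c. b @ c \<in> set (blocks w xs st)"
  using assms
proof (induction arbitrary: b rule: valid_blocks_induct)
  case (Inner w x xs b' st)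
  then show ?case by (cases "b = b'") (auto, metis append_assoc)
qed auto

section \<open>Triangularity of the products of traces\<close>

definition trace_prod :: "('x \<Rightarrow> 'f::field^2^2) \<Rightarrow> 'x list list \<Rightarrow> 'f" where
  "trace_prod \<phi> bs = (\<Prod>b\<leftarrow>bs. trace (mat_prod (map \<phi> b)))"

lemma trace_prod_simps [simp]:
  "trace_prod \<phi> [] = 1"
  "trace_prod \<phi> (b # bs) = trace (mat_prod (map \<phi> b)) * trace_prod \<phi> bs"
  by (simp_all add: trace_prod_def)

lemma trace_prod_eq_0:
  assumes "b \<in> set bs" "mat_prod (map \<phi> b) = 0"
  shows "trace_prod \<phi> bs = 0"
  using assms by (induction bs) (auto simp: trace_def)

text \<open>An open block with value 0 remains a prefix of a final block, whose trace then
  vanishes.\<close>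

lemma trace_prod_blocks_eq_0_stack:
  assumes "admissible w (length st)" "length w = length xs" "b \<in> set st" "mat_prod (map \<phi> b) = 0"
  shows "trace_prod \<phi> (blocks w xs st) = 0"
proof -
  obtain c where "b @ c \<in> set (blocks w xs st)"
    using blocks_extend_stack[OF assms(1-3)] by blast
  then show ?thesis
    by (rule trace_prod_eq_0) (simp add: mat_prod_append assms(4))
qed

lemma trace_prod_blocks_eq_0_var:
  assumes "admissible w (length st)" "length w = length xs" "x \<in> set xs" "\<phi> x = 0"
  shows "trace_prod \<phi> (blocks w xs st) = 0"
proof -
  have "x \<in> set (concat (blocks w xs st))"
    using mset_concat_blocks[OF assms(1,2)] assms(3) by (metis UnCI set_mset_mset set_mset_union)
  then obtain b where "b \<in> set (blocks w xs st)" "x \<in> set b" by auto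
  then show ?thesis
    using assms(4) by (intro trace_prod_eq_0 mat_prod_eq_0) (auto simp: image_iff intro!: bexI[of _ x])
qed

text \<open>Chosen so that replacing a letter by a different one of higher rank kills the trace
  product: after e12, \<open>Down\<close> tolerates only itself and \<open>Inner\<close> also
  \<open>Down\<close>, while a single \<open>Stay\<close> tolerates also
  \<open>Inner\<close>.\<close>

fun step_rank :: "step \<Rightarrow> nat" where
  "step_rank Down = 0"
| "step_rank Inner = 1"
| "step_rank Stay = 2"
| "step_rank Up = 3"

definition step_less :: "(step \<times> step) set" where
  "step_less = {(s, s'). step_rank s < step_rank s'}"

lemma mat_unit_mult [simp]:
  "mat_unit i j ** mat_unit k l = (if j = k then mat_unit i l else (0 :: 'f::field^2^2))"
  by (simp add: vec_eq_iff mat_unit_mult_nth) (simp add: mat_unit_def)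

lemma trace_mat_unit [simp]: "trace (mat_unit i j :: 'f::field^2^2) = (if i = j then 1 else 0)"
  using exhaust_2[of i] exhaust_2[of j] by (auto simp: trace_def mat_unit_def sum_2)

lemma trace_0 [simp]: "trace (0 :: 'f::field^2^2) = 0"
  by (simp add: trace_def)

text \<open>
  As long as \<open>w'\<close> agrees with \<open>w\<close>, every open block evaluates to \<open>e\<^sub>1\<^sub>2\<close>; at the first disagreement
  the trace product vanishes unless the letter of \<open>w'\<close> has smaller rank.
\<close>

lemma trace_prod_blocks_triangular:
  fixes \<phi> :: "'x \<Rightarrow> 'f::field^2^2"
  assumes "admissible w (length st)" "length w = length xs"
    and "map \<phi> xs = map step_unit w'"
    and "\<And>b. b \<in> set st \<Longrightarrow> mat_prod (map \<phi> b) = mat_unit 1 2"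
  shows "(trace_prod \<phi> (blocks w xs st) \<noteq> 0 \<longrightarrow> w = w' \<or> (w', w) \<in> lexord step_less) \<and>
    (w = w' \<longrightarrow> trace_prod \<phi> (blocks w xs st) = 1)"
  using assms
proof (induction arbitrary: w' rule: valid_blocks_induct)
  case Nil
  then show ?case by simp
next
  case (Up w x xs st)
  then obtain s v where w': "w' = s # v" "\<phi> x = step_unit s" "map \<phi> xs = map step_unit v"
    by (cases w') auto
  show ?case
  proof (cases "s = Up")
    case True
    have "mat_prod (map \<phi> b) = mat_unit 1 2" if "b \<in> set ([x] # st)" for b
      using that Up.prems(2) w'(2) True by auto
    then show ?thesis using Up.IH[OF w'(3)] True by (auto simp: w'(1))
  next
    case False
    then show ?thesis by (cases s) (auto simp: w'(1) step_less_def)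
  qed
next
  case (Stay w x xs st)
  then obtain s v where w': "w' = s # v" "\<phi> x = step_unit s" "map \<phi> xs = map step_unit v"
    by (cases w') auto
  \<comment> \<open>The block is a single matrix unit. Besides e11 only e22 has nonzero trace, and
    \<open>Inner\<close> has smaller rank than \<open>Stay\<close>.\<close>
  show ?case
    using Stay.IH[OF w'(3) Stay.prems(2)] w'(2) by (cases s) (auto simp: w'(1) step_less_def)
next
  case (Inner w x xs b st)
  then obtain s v where w': "w' = s # v" "\<phi> x = step_unit s" "map \<phi> xs = map step_unit v"
    by (cases w') auto
  have bx: "mat_prod (map \<phi> (b @ [x])) = mat_unit 1 2 ** step_unit s"
    using Inner.prems(2) w'(2) by (simp add: mat_prod_append)
  show ?case
  proof (cases "s = Inner")
    case True
    have "mat_prod (map \<phi> c) = mat_unit 1 2" if "c \<in> set ((b @ [x]) # st)" for c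
      using that Inner.prems(2) bx True by auto
    then show ?thesis using Inner.IH[OF w'(3)] True by (auto simp: w'(1))
  next
    case False
    \<comment> \<open>The product of e12 with e11 or e12 is 0, so the open block is dead.\<close>
    have "trace_prod \<phi> (blocks w xs ((b @ [x]) # st)) = 0" if "s \<noteq> Down"
      using Inner.hyps False that bx
      by (intro trace_prod_blocks_eq_0_stack[of _ _ _ "b @ [x]"]) (cases s; simp)+
    then show ?thesis using False by (cases s) (auto simp: w'(1) step_less_def)
  qed
next
  case (Down w x xs b st)
  then obtain s v where w': "w' = s # v" "\<phi> x = step_unit s" "map \<phi> xs = map step_unit v"
    by (cases w') auto
  have bx: "mat_prod (map \<phi> (b @ [x])) = mat_unit 1 2 ** step_unit s"
    using Down.prems(2) w'(2) by (simp add: mat_prod_append)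
  show ?case
  proof (cases "s = Down")
    case True
    then show ?thesis using Down.IH[OF w'(3)] Down.prems(2) bx by (auto simp: w'(1))
  next
    case False
    \<comment> \<open>Among the products of e12 with a matrix unit only e12 e21 = e11 has nonzero
      trace.\<close>
    then have "trace (mat_prod (map \<phi> (b @ [x]))) = 0"
      unfolding bx by (cases s) auto
    then show ?thesis using False by (simp add: w'(1))
  qed
qed

section \<open>Products of traces as entries of multilinear polynomials\<close>

fun splits :: "'x list list \<Rightarrow> ('x list \<times> 'x list) list" where
  "splits [] = [([], [])]"
| "splits (b # bs) = map (\<lambda>(u, v). (b @ u, v)) (splits bs) @ map (\<lambda>(u, v). (u, b @ v)) (splits bs)"

lemma mset_splits: "(u, v) \<in> set (splits bs) \<Longrightarrow> mset u + mset v = mset (concat bs)"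
  by (induction bs arbitrary: u v) force+

text \<open>
  The determinant of the first column of \<open>P\<close> and the second column of \<open>Q\<close>.  Since \<open>M\<close> acts on
  \<open>\<Lambda>\<^sup>2(F\<^sup>2)\<close> as multiplication by its trace, this produces products of traces.
\<close>

definition mixed_minor :: "'f::field^2^2 \<Rightarrow> 'f^2^2 \<Rightarrow> 'f" where
  "mixed_minor P Q = P $ 1 $ 1 * Q $ 2 $ 2 - P $ 2 $ 1 * Q $ 1 $ 2"

lemma mixed_minor_derivation:
  "mixed_minor (M ** P) Q + mixed_minor P (M ** Q) = trace M * mixed_minor P Q"
  by (simp add: mixed_minor_def matrix_matrix_mult_def trace_def sum_2 algebra_simps)

text \<open>The two halves of \<open>splits (b # bs)\<close> are the two terms of
  \<open>mixed_minor_derivation\<close>, so each block contributes its trace as a factor; the empty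
  product contributes the minor 1 of the identity.\<close>

lemma sum_list_splits:
  "(\<Sum>(u, v)\<leftarrow>splits bs. mixed_minor (mat_prod (map \<phi> u)) (mat_prod (map \<phi> v))) = trace_prod \<phi> bs"
proof (induction bs)
  case Nil
  show ?case by (simp add: mixed_minor_def mat_def)
next
  case (Cons b bs)
  have "(\<Sum>(u, v)\<leftarrow>splits (b # bs). mixed_minor (mat_prod (map \<phi> u)) (mat_prod (map \<phi> v))) =
    (\<Sum>(u, v)\<leftarrow>splits bs. trace (mat_prod (map \<phi> b)) * mixed_minor (mat_prod (map \<phi> u)) (mat_prod (map \<phi> v)))"
    by (simp add: comp_def case_prod_unfold mat_prod_append flip: sum_list_addf mixed_minor_derivation)
  then show ?case
    using Cons by (simp add: case_prod_unfold sum_list_const_mult)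
qed

text \<open>
  With \<open>e\<^sub>1\<^sub>1, e\<^sub>1\<^sub>2, e\<^sub>2\<^sub>1\<close> substituted for the three additional variables, the \<open>(1, 1)\<close> entries of the two
  monomials are \<open>P\<^sub>1\<^sub>1 Q\<^sub>2\<^sub>2\<close> and \<open>Q\<^sub>1\<^sub>2 P\<^sub>2\<^sub>1\<close>, where \<open>P\<close> and \<open>Q\<close> are the values of \<open>u\<close> and \<open>v\<close>.
\<close>

definition trace_poly :: "nat \<Rightarrow> (T2 \<times> nat) list list \<Rightarrow> (T2, 'f::field) gr_poly" where
  "trace_poly n bs = (\<Sum>(u, v)\<leftarrow>splits bs.
     monomial (u @ (T2_zero, n + 1) # (T2_zero, n + 2) # v @ [(T2_zero, n + 3)])
   - monomial (v @ (T2_zero, n + 3) # (T2_zero, n + 2) # u @ [(T2_zero, n + 1)]))"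

lemma trace_poly_multilinear:
  assumes "mset (map snd (concat bs)) = mset [1..<Suc n]"
  shows "(trace_poly n bs :: (T2, 'f::field) gr_poly) \<in> multilinear_polys (n + 3)"
proof -
  interpret P: vector_space "poly_scale :: 'f \<Rightarrow> (T2, 'f) gr_poly \<Rightarrow> _"
    by (rule vector_space_poly_scale)
  have "[1..<Suc (n + 3)] = [1..<Suc n] @ [n + 1, n + 2, n + 3]"
    by (simp add: numeral_3_eq_3)
  moreover have "mset (map snd u) + mset (map snd v) = mset [1..<Suc n]"
    if "(u, v) \<in> set (splits bs)" for u v
    using mset_splits[OF that] assms by (metis image_mset_union mset_map)
  ultimately have words: "u @ (T2_zero, n + 1) # (T2_zero, n + 2) # v @ [(T2_zero, n + 3)] \<in> multilinear_words (n + 3)"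
    "v @ (T2_zero, n + 3) # (T2_zero, n + 2) # u @ [(T2_zero, n + 1)] \<in> multilinear_words (n + 3)"
    if "(u, v) \<in> set (splits bs)" for u v
    using that unfolding multilinear_words_iff by (simp_all add: ac_simps del: upt_Suc)
  have sum: "(\<Sum>x\<leftarrow>xs. h x) \<in> P.span S" if "\<And>x. x \<in> set xs \<Longrightarrow> h x \<in> P.span S" for xs h S
    using that by (induction xs) (auto intro: P.span_zero P.span_add)
  show ?thesis
    unfolding trace_poly_def multilinear_polys_eq
    by (rule sum, unfold split_paired_all case_prod_conv) (intro P.span_diff P.span_base imageI words; assumption)
qed

lemma entry_trace_poly:
  fixes \<phi> :: "T2 \<times> nat \<Rightarrow> 'f::field A2"
  assumes "mat_part (\<phi> (T2_zero, n + 1)) = mat_unit 1 1"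
    and "mat_part (\<phi> (T2_zero, n + 2)) = mat_unit 1 2"
    and "mat_part (\<phi> (T2_zero, n + 3)) = mat_unit 2 1"
  shows "mat_part (substitute A2_scale \<phi> (trace_poly n bs)) $ 1 $ 1 = trace_prod (\<lambda>x. mat_part (\<phi> x)) bs"
proof -
  let ?e = "\<lambda>f. mat_part (substitute A2_scale \<phi> f) $ 1 $ 1"
  interpret E: Vector_Spaces.linear poly_scale "(*) :: 'f \<Rightarrow> 'f \<Rightarrow> 'f" ?e
    by (rule linear_entry)
  have sum: "?e (\<Sum>x\<leftarrow>xs. h x) = (\<Sum>x\<leftarrow>xs. ?e (h x))" for xs :: "'q list" and h :: "_ \<Rightarrow> (T2, 'f) gr_poly"
    by (induction xs) (simp_all add: E.zero E.add)
  have entry: "?e (monomial (u @ (T2_zero, n + 1) # (T2_zero, n + 2) # v @ [(T2_zero, n + 3)])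
      - monomial (v @ (T2_zero, n + 3) # (T2_zero, n + 2) # u @ [(T2_zero, n + 1)])) =
    mixed_minor (mat_prod (map (\<lambda>x. mat_part (\<phi> x)) u)) (mat_prod (map (\<lambda>x. mat_part (\<phi> x)) v))" for u v
    using assms
    by (simp add: E.diff entry_monomial mat_prod_append mixed_minor_def)
      (simp add: matrix_matrix_mult_def sum_2 mat_unit_def)
  have "?e (trace_poly n bs) = (\<Sum>(u, v)\<leftarrow>splits bs.
      mixed_minor (mat_prod (map (\<lambda>x. mat_part (\<phi> x)) u)) (mat_prod (map (\<lambda>x. mat_part (\<phi> x)) v)))"
    unfolding trace_poly_def sum
    by (intro arg_cong[of _ _ sum_list] map_cong refl) (simp only: case_prod_unfold entry)
  then show ?thesis
    by (simp only: sum_list_splits)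
qed

section \<open>The triangular system of words and polynomials\<close>

definition valid_words :: "nat \<Rightarrow> nat \<Rightarrow> (step \<times> T2) list set" where
  "valid_words n h = {ws. length ws = n \<and> set ws \<subseteq> graded_steps \<and> admissible (map fst ws) h}"

lemma finite_valid_words: "finite (valid_words n h)"
  by (rule finite_subset[OF _ finite_lists_length_eq[of graded_steps n]])
    (auto simp: valid_words_def graded_steps_eq)

definition word_vars :: "(step \<times> T2) list \<Rightarrow> (T2 \<times> nat) list" where
  "word_vars ws = zip (map snd ws) [1..<Suc (length ws)]"

text \<open>Position 0 is never used, since variables are numbered from 1.\<close>

definition word_point :: "(step \<times> T2) list \<Rightarrow> nat \<Rightarrow> step \<times> T2" where
  "word_point ws i = ((Stay, T2_zero) # ws @ [(Stay, T2_zero), (Up, T2_zero), (Down, T2_zero)]) ! i"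

lemma map_word_vars:
  assumes "length ws = length ws'" "set ws' \<subseteq> graded_steps"
  shows "map (\<lambda>x. mat_part (eval_at (word_point ws') x)) (word_vars ws) =
    map2 (\<lambda>t b. if snd b = t then step_unit (fst b) else (0 :: 'f::field^2^2)) (map snd ws) ws'"
proof (rule nth_equalityI)
  fix k assume "k < length (map (\<lambda>x. mat_part (eval_at (word_point ws') x) :: 'f^2^2) (word_vars ws))"
  then have k: "k < length ws" by (simp add: word_vars_def del: upt_Suc)
  then have "word_point ws' (Suc k) = ws' ! k" "ws' ! k \<in> graded_steps"
    using assms by (auto simp: word_point_def nth_append)
  then show "map (\<lambda>x. mat_part (eval_at (word_point ws') x)) (word_vars ws) ! k =
      map2 (\<lambda>t b. if snd b = t then step_unit (fst b) else (0 :: 'f^2^2)) (map snd ws) ws' ! k"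
    using k assms(1) by (simp add: word_vars_def mat_part_eval_at del: upt_Suc)
qed (simp add: word_vars_def assms del: upt_Suc)

text \<open>If the degrees of the two words differ somewhere, a variable is evaluated at 0 and the
  product vanishes. Otherwise distinct words differ in their steps, and the triangularity for step
  words applies.\<close>

lemma trace_prod_word_point:
  fixes ws ws' :: "(step \<times> T2) list"
  assumes "ws \<in> valid_words n 0" "ws' \<in> valid_words n 0"
  defines "\<phi> \<equiv> \<lambda>x. mat_part (eval_at (word_point ws') x) :: 'f::field^2^2"
    and "bs \<equiv> blocks (map fst ws) (word_vars ws) []"
  shows "ws = ws' \<Longrightarrow> trace_prod \<phi> bs = 1"
    and "trace_prod \<phi> bs \<noteq> 0 \<Longrightarrow> ws \<noteq> ws' \<Longrightarrow> (map fst ws', map fst ws) \<in> lexord step_less"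
proof -
  have len: "length ws = n" "length ws' = n" and gs: "set ws' \<subseteq> graded_steps"
    and v: "admissible (map fst ws) (length ([] :: (T2 \<times> nat) list list))"
      "length (map fst ws) = length (word_vars ws)"
    using assms by (auto simp: valid_words_def word_vars_def simp del: upt_Suc)
  have map_\<phi>: "map \<phi> (word_vars ws) = map2 (\<lambda>t b. if snd b = t then step_unit (fst b) else 0) (map snd ws) ws'"
    unfolding \<phi>_def using len gs by (intro map_word_vars) auto
  have eq: "map \<phi> (word_vars ws) = map step_unit (map fst ws')" if "map snd ws = map snd ws'"
    unfolding map_\<phi> that by (rule nth_equalityI) auto
  note tri = trace_prod_blocks_triangular[OF v, of \<phi> "map fst ws'", folded bs_def]
  show "trace_prod \<phi> bs = 1" if "ws = ws'"
    using tri eq that by auto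
  assume nz: "trace_prod \<phi> bs \<noteq> 0" and ne: "ws \<noteq> ws'"
  have "0 \<notin> set (map \<phi> (word_vars ws))"
    using trace_prod_blocks_eq_0_var[OF v, of _ \<phi>] nz by (auto simp: bs_def)
  then have "map snd ws ! k = map snd ws' ! k" if "k < n" for k
  proof -
    have "map \<phi> (word_vars ws) ! k \<noteq> 0"
      using \<open>0 \<notin> _\<close> that len v(2) by (metis length_map nth_mem)
    then show ?thesis
      using that len by (simp add: map_\<phi> split: if_splits)
  qed
  then have snd_eq: "map snd ws = map snd ws'"
    using len by (intro nth_equalityI) auto
  then have "map fst ws \<noteq> map fst ws'"
    using ne by (metis zip_map_fst_snd)
  then show "(map fst ws', map fst ws) \<in> lexord step_less"
    using tri eq[OF snd_eq] nz by auto
qed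

text \<open>Each word yields a polynomial \<open>g ws\<close> and a functional \<open>l ws\<close>,
  the (1, 1) entry at its own point. The substitution is graded, so the functionals vanish on
  identities, and their values on the polynomials form a triangular matrix.\<close>

lemma graded_codim_ge:
  "card (valid_words n 0) \<le> graded_codim (A2_scale :: 'f::field \<Rightarrow> 'f A2 \<Rightarrow> 'f A2) A2_grading (n + 3)"
proof -
  interpret P: vector_space "poly_scale :: 'f \<Rightarrow> (T2, 'f) gr_poly \<Rightarrow> _"
    by (rule vector_space_poly_scale)
  let ?V = "multilinear_polys (n + 3) :: (T2, 'f) gr_poly set"
  let ?I = "graded_identities (A2_scale :: 'f \<Rightarrow> 'f A2 \<Rightarrow> 'f A2) A2_grading"
  define l :: "_ \<Rightarrow> (T2, 'f) gr_poly \<Rightarrow> 'f"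
    where "l ws f = mat_part (substitute A2_scale (eval_at (word_point ws)) f) $ 1 $ 1" for ws f
  define bs where "bs ws = blocks (map fst ws) (word_vars ws) []" for ws
  define g :: "_ \<Rightarrow> (T2, 'f) gr_poly" where "g ws = trace_poly n (bs ws)" for ws
  have lg: "l ws' (g ws) = trace_prod (\<lambda>x. mat_part (eval_at (word_point ws') x)) (bs ws)"
    if "ws' \<in> valid_words n 0" for ws ws'
  proof -
    have "word_point ws' (n + 1) = (Stay, T2_zero)" "word_point ws' (n + 2) = (Up, T2_zero)"
      "word_point ws' (n + 3) = (Down, T2_zero)"
      using that by (auto simp: word_point_def valid_words_def nth_append numeral_3_eq_3)
    then show ?thesis
      unfolding l_def g_def by (intro entry_trace_poly) (simp_all add: mat_part_eval_at graded_steps_eq)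
  qed
  have "trans step_less" "\<forall>s. (s, s) \<notin> step_less"
    by (auto simp: step_less_def trans_def)
  then have "trans (lexord step_less)" "irrefl (lexord step_less)"
    by (simp_all add: lexord_transI irrefl_def lexord_irreflexive)
  \<comment> \<open>Only the steps are compared: words with equal steps and different degrees are
    unrelated, and the corresponding matrix entry is 0.\<close>
  then have r: "trans (inv_image (lexord step_less) (map (fst :: step \<times> T2 \<Rightarrow> step)))"
    "irrefl (inv_image (lexord step_less) (map (fst :: step \<times> T2 \<Rightarrow> step)))"
    by (auto intro: trans_inv_image simp: irrefl_def)
  have "card (valid_words n 0) \<le>
      vectorspace.dim field_ring (quotient_module (subspace_module poly_scale ?V) (?V \<inter> ?I))"
  proof (rule dim_quotient_ge[OF vector_space_poly_scale _ _ multilinear_polys_eq _ finite_valid_words, where r = "inv_image (lexord step_less) (map fst)"])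
    show "P.subspace (?V \<inter> ?I)"
      by (intro P.subspace_inter A2.subspace_graded_identities) (simp add: multilinear_polys_def)
    show "Vector_Spaces.linear poly_scale (*) (l ws)" for ws
      unfolding l_def by (rule linear_entry)
    show "l ws f = 0" if "f \<in> ?V \<inter> ?I" for ws f
      using that by (auto simp: l_def graded_identities_def eval_at_def eval_step_in_grading zero_A2_def)
    show "g ws \<in> ?V" if ws: "ws \<in> valid_words n 0" for ws
    proof -
      have "mset (concat (bs ws)) = mset (word_vars ws)"
        using ws mset_concat_blocks[of "map fst ws" "[]" "word_vars ws"]
        by (simp add: bs_def valid_words_def word_vars_def del: upt_Suc)
      then have "mset (map snd (concat (bs ws))) = mset (map snd (word_vars ws))"
        by (metis mset_map)
      also have "map snd (word_vars ws) = [1..<Suc n]"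
        using ws by (simp add: word_vars_def valid_words_def del: upt_Suc)
      finally show ?thesis
        unfolding g_def by (rule trace_poly_multilinear)
    qed
    show "l ws (g ws) \<noteq> 0" if "ws \<in> valid_words n 0" for ws
      using trace_prod_word_point(1)[where ?'f = 'f, OF that that refl] by (simp add: lg that bs_def)
    show "(ws', ws) \<in> inv_image (lexord step_less) (map fst)"
      if "ws \<in> valid_words n 0" "ws' \<in> valid_words n 0" "l ws' (g ws) \<noteq> 0" "ws \<noteq> ws'" for ws ws'
      using trace_prod_word_point(2)[where ?'f = 'f, OF that(1,2) _ that(4)] that(3)
      by (simp add: lg that(2) bs_def)
  qed (use r finite_multilinear_words in auto)
  then show ?thesis
    by (simp add: graded_codim_def)
qed

section \<open>Counting words\<close>

lemma card_valid_words_0: "card (valid_words 0 h) = of_bool (h = 0)"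
proof -
  have "valid_words 0 h = (if h = 0 then {[]} else {})"
    by (auto simp: valid_words_def)
  then show ?thesis by simp
qed

text \<open>Split off the first letter: \<open>Up\<close>, \<open>Stay\<close> and
  \<open>Inner\<close> occur in both degrees, \<open>Down\<close> only in degree
  \<open>T2_zero\<close>.\<close>

lemma card_valid_words_Suc:
  "card (valid_words (Suc n) h) = 2 * card (valid_words n (Suc h)) + 2 * card (valid_words n h)
    + of_bool (h > 0) * (2 * card (valid_words n h) + card (valid_words n (h - 1)))"
proof -
  \<comment> \<open>The truncated \<open>h - 1\<close> at height 0 does no harm, since
    \<open>B\<close> excludes \<open>Down\<close> there.\<close>
  define next_height where "next_height b = (case fst b of Up \<Rightarrow> Suc h | Stay \<Rightarrow> h | Inner \<Rightarrow> h | Down \<Rightarrow> h - 1)"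
    for b :: "step \<times> T2"
  define B where "B = {b \<in> graded_steps. fst b \<in> {Inner, Down} \<longrightarrow> h > 0}"
  have fin: "finite B" by (simp add: B_def graded_steps_eq)
  have step: "b # ws \<in> valid_words (Suc n) h \<longleftrightarrow> b \<in> B \<and> ws \<in> valid_words n (next_height b)" for b ws
    by (cases "fst b") (auto simp: valid_words_def B_def next_height_def)
  have "ws \<in> valid_words (Suc n) h \<longleftrightarrow> ws \<in> (\<Union>b\<in>B. (#) b ` valid_words n (next_height b))" for ws
  proof (cases ws)
    case Nil
    then show ?thesis by (auto simp: valid_words_def)
  next
    case (Cons b vs)
    then show ?thesis by (auto simp: step)
  qed
  then have "valid_words (Suc n) h = (\<Union>b\<in>B. (#) b ` valid_words n (next_height b))"
    by blast
  then have "card (valid_words (Suc n) h) = card (\<Union>b\<in>B. (#) b ` valid_words n (next_height b))"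
    by simp
  also have "\<dots> = (\<Sum>b\<in>B. card (valid_words n (next_height b)))"
    using fin by (subst card_UN_disjoint) (auto simp: finite_valid_words card_image)
  also have "\<dots> = (\<Sum>b\<in>graded_steps. if fst b \<in> {Inner, Down} \<longrightarrow> h > 0 then card (valid_words n (next_height b)) else 0)"
    unfolding B_def by (intro sum.inter_filter) (simp add: graded_steps_eq)
  also have "\<dots> = 2 * card (valid_words n (Suc h)) + 2 * card (valid_words n h)
    + of_bool (h > 0) * (2 * card (valid_words n h) + card (valid_words n (h - 1)))"
    by (simp add: graded_steps_eq next_height_def)
  finally show ?thesis .
qed

text \<open>Descend to height 0 by \<open>Down\<close>, then continue with
  \<open>Stay\<close>.\<close>

lemma card_valid_words_pos: "h \<le> n \<Longrightarrow> card (valid_words n h) > 0"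
proof (induction n arbitrary: h)
  case 0
  then show ?case by (simp add: card_valid_words_0)
next
  case (Suc n)
  then show ?case
    using Suc.IH[of 0] Suc.IH[of "h - 1"] by (cases h) (auto simp: card_valid_words_Suc)
qed

text \<open>The vector \<open>h \<mapsto> 2 powr (- h / 2) * sin (\<pi> h / Suc L)\<close> is an eigenvector of the recursion
  truncated to heights at most \<open>L\<close>.\<close>

lemma card_valid_words_ge:
  fixes L :: nat
  assumes L: "L \<ge> 1"
  defines "\<theta> \<equiv> pi / real (Suc L)"
  assumes h: "h \<le> Suc L"
  shows "real (card (valid_words (L + n) h)) \<ge> (4 + 2 * sqrt 2 * cos \<theta>) ^ n * sin (real h * \<theta>) / sqrt 2 ^ h"
  using h
proof (induction n arbitrary: h)
  case 0
  show ?case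
  proof (cases "h = Suc L")
    case True
    then show ?thesis by (simp add: \<theta>_def)
  next
    case False
    \<comment> \<open>Length \<open>L\<close> suffices for a word from every height up to
      \<open>L\<close>; this is why the lengths start at \<open>L\<close>.\<close>
    then have "real (card (valid_words L h)) \<ge> 1"
      using card_valid_words_pos[of h L] 0 by simp
    moreover have "sin (real h * \<theta>) / sqrt 2 ^ h \<le> 1"
      using order_trans[OF sin_le_one one_le_power[of "sqrt 2" h]] by (simp add: divide_le_eq)
    ultimately have "sin (real h * \<theta>) / sqrt 2 ^ h \<le> real (card (valid_words L h))"
      by linarith
    then show ?thesis by simp
  qed
next
  case (Suc n)
  let ?W = "\<lambda>h. real (card (valid_words (L + n) h))"
  let ?l = "4 + 2 * sqrt 2 * cos \<theta>"
  show ?case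
  proof (cases "h = 0 \<or> h = Suc L")
    case True
    then show ?thesis by (auto simp: \<theta>_def)
  next
    case False
    then obtain k where k: "h = Suc k" "Suc h \<le> Suc L"
      using Suc.prems by (cases h) auto
    have "?l ^ Suc n * sin (real h * \<theta>) / sqrt 2 ^ h
      = 4 * (?l ^ n * sin (real h * \<theta>) / sqrt 2 ^ h)
      + 2 * (?l ^ n * sin (real (Suc h) * \<theta>) / sqrt 2 ^ Suc h)
      + ?l ^ n * sin (real k * \<theta>) / sqrt 2 ^ k"
    proof -
      have "real (Suc h) * \<theta> = real h * \<theta> + \<theta>" "real k * \<theta> = real h * \<theta> - \<theta>"
        by (simp_all add: k(1) algebra_simps)
      \<comment> \<open>The three-term recursion of the sine. The factor
        \<open>1 / sqrt 2 ^ h\<close> balances the coefficient 2 of a step up against the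
        coefficient 1 of a step down.\<close>
      then have e: "sin (real (Suc h) * \<theta>) = 2 * cos \<theta> * sin (real h * \<theta>) - sin (real k * \<theta>)"
        by (simp only: sin_add sin_diff) (simp add: algebra_simps)
      have "(4 + 2 * q * c) * P * s / (q * Q) = 4 * (P * s / (q * Q)) + 2 * (P * (2 * c * s - t) / (2 * Q)) + P * t / Q"
        if "q \<noteq> 0" "Q \<noteq> 0" for q c P s t Q :: real
        using that by (simp add: field_simps)
      note algebra = this[of "sqrt 2" "sqrt 2 ^ k" "cos \<theta>" "?l ^ n" "sin (real h * \<theta>)" "sin (real k * \<theta>)"]
      have sqrt2: "sqrt 2 * (sqrt 2 * x) = 2 * x" for x :: real
        by (simp flip: mult.assoc)
      show ?thesis
        unfolding e using algebra by (simp add: k(1) sqrt2 del: of_nat_Suc)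
    qed
    also have "\<dots> \<le> 4 * ?W h + 2 * ?W (Suc h) + ?W k"
      using Suc.IH[of h] Suc.IH[of "Suc h"] Suc.IH[of k] k by simp
    also have "\<dots> = real (card (valid_words (L + Suc n) h))"
      by (simp add: card_valid_words_Suc k(1))
    finally show ?thesis .
  qed
qed

text \<open>Constant factors disappear under the \<open>n\<close>-th root, and lower rates
  arbitrarily close to \<open>\<mu>\<close> suffice.\<close>

lemma root_tendsto_sandwich:
  fixes c :: "nat \<Rightarrow> real"
  assumes up: "\<And>n. n \<ge> 2 \<Longrightarrow> c n \<le> K * \<mu> ^ n" and K: "K > 0" and \<mu>: "\<mu> > 0"
    and low: "\<And>x. x < \<mu> \<Longrightarrow> \<exists>\<rho> C N. x < \<rho> \<and> 0 < \<rho> \<and> 0 < C \<and> (\<forall>n\<ge>N. C * \<rho> ^ n \<le> c n)"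
  shows "(\<lambda>n. root n (c n)) \<longlonglongrightarrow> \<mu>"
proof (rule order_tendstoI)
  have lim: "(\<lambda>n. root n (C * \<rho> ^ n)) \<longlonglongrightarrow> \<rho>" if "C > 0" "\<rho> > 0" for C \<rho> :: real
  proof -
    have "(\<lambda>n. root n C * \<rho>) \<longlonglongrightarrow> 1 * \<rho>"
      using LIMSEQ_root_const[OF that(1)] by (intro tendsto_intros)
    moreover have "\<forall>\<^sub>F n in sequentially. root n C * \<rho> = root n (C * \<rho> ^ n)"
      using eventually_gt_at_top[of 0]
      by eventually_elim (use that in \<open>simp add: real_root_mult real_root_power_cancel\<close>)
    ultimately show ?thesis by (simp add: tendsto_cong)
  qed
  fix x
  show "\<forall>\<^sub>F n in sequentially. x < root n (c n)" if x: "x < \<mu>"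
  proof -
    obtain \<rho> C N where l: "x < \<rho>" "0 < \<rho>" "0 < C" "\<And>n. n \<ge> N \<Longrightarrow> C * \<rho> ^ n \<le> c n"
      using low[OF x] by blast
    from order_tendstoD(1)[OF lim[OF l(3,2)] l(1)] eventually_ge_at_top[of "max N 1"]
    show ?thesis
    proof eventually_elim
      case (elim n)
      then have "root n (C * \<rho> ^ n) \<le> root n (c n)"
        using l(4)[of n] by (intro real_root_le_mono) auto
      then show ?case using elim by linarith
    qed
  qed
  show "\<forall>\<^sub>F n in sequentially. root n (c n) < x" if x: "\<mu> < x"
    using order_tendstoD(2)[OF lim[OF K \<mu>] x] eventually_ge_at_top[of 2]
  proof eventually_elim
    case (elim n)
    then have "root n (c n) \<le> root n (K * \<mu> ^ n)"
      using up[of n] by (intro real_root_le_mono) auto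
    then show ?case using elim by linarith
  qed
qed

text \<open>As \<open>L\<close> grows, the cosine tends to 1; positivity holds eventually because
  the limit is positive.\<close>

lemma exists_rate:
  assumes "x < 4 + 2 * sqrt 2"
  obtains L :: nat where "L \<ge> 1" "x < 4 + 2 * sqrt 2 * cos (pi / real (Suc L))" "0 < 4 + 2 * sqrt 2 * cos (pi / real (Suc L))"
proof -
  have "(\<lambda>L. 4 + 2 * sqrt 2 * cos (pi * inverse (real (Suc L)))) \<longlonglongrightarrow> 4 + 2 * sqrt 2 * cos (pi * 0)"
    by (intro tendsto_intros LIMSEQ_inverse_real_of_nat)
  then have lim: "(\<lambda>L. 4 + 2 * sqrt 2 * cos (pi / real (Suc L))) \<longlonglongrightarrow> 4 + 2 * sqrt 2"
    by (simp add: divide_inverse)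
  have "\<forall>\<^sub>F L in sequentially. L \<ge> 1 \<and> x < 4 + 2 * sqrt 2 * cos (pi / real (Suc L)) \<and> 0 < 4 + 2 * sqrt 2 * cos (pi / real (Suc L))"
    using assms by (intro eventually_conj eventually_ge_at_top order_tendstoD(1)[OF lim]) (auto intro: add_pos_pos)
  then show ?thesis
    using that eventually_happens'[OF sequentially_bot] by blast
qed

text \<open>The eigenvector vanishes at height 0, so the estimate is applied at height 1, after a
  first letter \<open>Up\<close>. The exponent \<open>n + 3\<close> anticipates the three additional
  variables.\<close>

lemma card_valid_words_0_ge:
  assumes L: "L \<ge> 1"
  defines "\<rho> \<equiv> 4 + 2 * sqrt 2 * cos (pi / real (Suc L))"
  assumes pos: "\<rho> > 0"
  shows "\<exists>C N. 0 < C \<and> (\<forall>n\<ge>N. C * \<rho> ^ (n + 3) \<le> real (card (valid_words n 0)))"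
proof -
  let ?s = "sin (pi / real (Suc L)) / sqrt 2"
  have s: "?s > 0"
    using L by (intro divide_pos_pos sin_gt_zero) (auto simp: field_simps)
  \<comment> \<open>With \<open>n = Suc (L + m)\<close> the exponent \<open>n + 3\<close> equals
    \<open>m + (L + 4)\<close>, which explains the denominator.\<close>
  have "?s / \<rho> ^ (L + 4) * \<rho> ^ (n + 3) \<le> real (card (valid_words n 0))" if n: "n \<ge> Suc L" for n
  proof -
    define m where "m = n - Suc L"
    have m: "n = Suc (L + m)" using n by (simp add: m_def)
    have "?s / \<rho> ^ (L + 4) * \<rho> ^ (n + 3) = \<rho> ^ m * ?s"
      using pos by (simp add: m power_add field_simps eval_nat_numeral)
    also have "\<dots> \<le> real (card (valid_words (L + m) 1))"
      using card_valid_words_ge[OF L, of 1 m] by (simp add: \<rho>_def)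
    also have "\<dots> \<le> real (card (valid_words n 0))"
      by (simp add: m card_valid_words_Suc)
    finally show ?thesis .
  qed
  moreover have "?s / \<rho> ^ (L + 4) > 0"
    by (rule divide_pos_pos[OF s]) (simp add: pos)
  ultimately show ?thesis by blast
qed

theorem theorem4:
  shows "(\<lambda>n. root n (real (graded_codim (A2_scale :: 'f::field_char_0 \<Rightarrow> 'f A2 \<Rightarrow> 'f A2) A2_grading n)))
           \<longlonglongrightarrow> 4 + 2 * sqrt 2
         \<and> 6.8284 < 4 + 2 * sqrt 2 \<and> 4 + 2 * sqrt 2 < (6.8285 :: real)"
proof (intro conjI)
  let ?c = "\<lambda>n. real (graded_codim (A2_scale :: 'f \<Rightarrow> 'f A2 \<Rightarrow> 'f A2) A2_grading n)"
  show "(\<lambda>n. root n (?c n)) \<longlonglongrightarrow> 4 + 2 * sqrt 2"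
  proof (rule root_tendsto_sandwich[where K = "4 * sqrt 2"])
    fix n :: nat assume n: "n \<ge> 2"
    have "?c n \<le> 4 * real (card {a \<in> {1..n} \<rightarrow>\<^sub>E graded_steps. \<bar>\<Sum>i\<in>{1..n}. step_weight (fst (a i))\<bar> \<le> 1})"
      using graded_codim_le[OF n, where ?'f = 'f] by linarith
    also have "\<dots> \<le> 4 * (sqrt 2 * (4 + 2 * sqrt 2) ^ n)"
      by (intro mult_left_mono card_bounded_weight_le) simp
    finally show "?c n \<le> 4 * sqrt 2 * (4 + 2 * sqrt 2) ^ n"
      by simp
  next
    fix x :: real assume "x < 4 + 2 * sqrt 2"
    then obtain L :: nat where L: "L \<ge> 1" and x: "x < 4 + 2 * sqrt 2 * cos (pi / real (Suc L))"
      and pos: "0 < 4 + 2 * sqrt 2 * cos (pi / real (Suc L))"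
      by (rule exists_rate)
    define \<rho> where "\<rho> = 4 + 2 * sqrt 2 * cos (pi / real (Suc L))"
    obtain C N where C: "0 < C" and ge: "\<And>n. n \<ge> N \<Longrightarrow> C * \<rho> ^ (n + 3) \<le> real (card (valid_words n 0))"
      using card_valid_words_0_ge[OF L pos] unfolding \<rho>_def by blast
    have "C * \<rho> ^ n \<le> ?c n" if "n \<ge> N + 3" for n
    proof -
      have "C * \<rho> ^ n \<le> real (card (valid_words (n - 3) 0))"
        using ge[of "n - 3"] that by simp
      also have "\<dots> \<le> ?c n"
        using graded_codim_ge[of "n - 3", where ?'f = 'f] that by simp
      finally show ?thesis .
    qed
    then show "\<exists>\<rho> C N. x < \<rho> \<and> 0 < \<rho> \<and> 0 < C \<and> (\<forall>n\<ge>N. C * \<rho> ^ n \<le> ?c n)"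
      using x pos C unfolding \<rho>_def by blast
  qed (auto intro: add_pos_pos)
  \<comment> \<open>Doubling these bounds and adding 4 gives 6.8284 and 6.8285.\<close>
  have "1.4142 < sqrt (2 :: real)"
    by (rule real_less_rsqrt) (simp add: power2_eq_square)
  moreover have "sqrt (2 :: real) < 1.41425"
    by (rule real_less_lsqrt) (simp_all add: power2_eq_square)
  ultimately show "6.8284 < 4 + 2 * sqrt 2" "4 + 2 * sqrt 2 < (6.8285 :: real)"
    by simp_all
qed

end
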